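(* Let $n>m$ and let the setting be as described in the context. Maximizing the principal's profits is equivalent to maximizing her effective profits. That is, the supremum of the principal's profit $P$ over price schedules $v$ with $v^b\in U_{b,\phi}$ and over choice functions $y_{v^b}(x)\in\operatorname{argmax}_{y\in\overline Y}(b(x,y)-v(y))$ equals the supremum of the effective profit $P_{eff}$ over effective price schedules $p$ with $p^h\ge u_\phi$ and over choice functions $w_{p^h}(x)\in\operatorname{argmax}_{w\in W}(h(x,w)-p(w))$; and a utility function $u$ is the utility of a maximizer of the first problem if and only if it is the utility of a maximizer of the second.
   Context: $X\subset\mathbb{R}^m$ and $Y\subset\mathbb{R}^n$ are nonempty, open and bounded, $n>m$, and $b\in C^4(\overline X\times\overline Y)$. For all $x_0\in\overline X$, $y_0\in\overline Y$, the level sets of $y\mapsto D_xb(x_0,y)$ and of $x\mapsto D_yb(x,y_0)$ are connected and the $m\times n$ matrix $D^2_{xy}b(x_0,y_0)$ has full rank. $\overline X$ is $b$-convex: $D_yb(\overline X,y_0)\subseteq\mathbb{R}^n$ is convex for every $y_0\in\overline Y$. In this setting the sets $L_y(x)=\{\overline y\in\overline Y: D_xb(x,\overline y)=D_xb(x,y)\}$ are independent of $x$. Fix $x_0\in X$. Let $Q(y)=D_xb(x_0,y)$ for $y\in\overline Y$ and $W=Q(\overline Y)\subseteq\mathbb{R}^m$. The effective preference function is $h(x,w)=b(x,y)-b(x_0,y)$ for any $y\in Q^{-1}(w)$; this is well defined. With $c:\overline Y\to\mathbb{R}$ the production cost, the effective cost is $g(w)=\inf_{\{y:Q(y)=w\}}(c(y)-b(x_0,y))$;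 this infimum is assumed to be attained for every $w\in W$. Types are distributed according to a measure $\mu$ on $X$ given by a density with respect to Lebesgue measure. A price schedule is a function $v:\overline Y\to\mathbb{R}\cup\{+\infty\}$, with utility $v^b(x)=\sup_{y\in\overline Y}(b(x,y)-v(y))$, assumed finite on $X$; an effective price schedule is a function $p:W\to\mathbb{R}\cup\{+\infty\}$, with utility $p^h(x)=\sup_{w\in W}(h(x,w)-p(w))$, assumed finite on $X$. A point $y_\phi\in\overline Y$ is fixed, $u_\phi(x)=b(x,y_\phi)-c(y_\phi)$, and $U_{b,\phi}$ is the set of functions on $X$ of the form $v^b$ that satisfy $v^b\ge u_\phi$ on $X$. The profits are $$P=\int_X\big(b(x,y_{v^b}(x))-v^b(x)-c(y_{v^b}(x))\big)d\mu(x),\qquad P_{eff}=\int_X\big(h(x,w_{p^h}(x))-p^h(x)-g(w_{p^h}(x))\big)d\mu(x).$$ Only schedules and choice functions for which the maximizers exist (for almost every $x$) and these integrals are well defined are considered.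
   Formalization: In the last clause, a maximizer is required to have finite profit; without this the equivalence can fail when the maximal profit is +infinity and the cost c is not measurable, since the effective profit may then be undefined. *)

theory Defs
  imports "HOL-Analysis.Analysis"
begin

(* On an open subset of a Euclidean space this is the usual class C^k: all iterated directional
   derivatives up to order k exist and are continuous. *)
primrec Ck_on :: "nat \<Rightarrow> 'a::euclidean_space set \<Rightarrow> ('a \<Rightarrow> real) \<Rightarrow> bool" where
  "Ck_on 0 U f \<longleftrightarrow> continuous_on U f"
| "Ck_on (Suc k) U f \<longleftrightarrow>
     (\<forall>z\<in>U. f differentiable at z) \<and> (\<forall>e. Ck_on k U (\<lambda>z. frechet_derivative f (at z) e))"

(* Class C^k up to the boundary of the closed set S: f is C^k on an open neighbourhood of S. *)
definition Ck_nbhd :: "nat \<Rightarrow> 'a::euclidean_space set \<Rightarrow> ('a \<Rightarrow> real) \<Rightarrow> bool" where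
  "Ck_nbhd k S f \<longleftrightarrow> (\<exists>U. open U \<and> S \<subseteq> U \<and> Ck_on k U f)"

definition Dx :: "(real^'m \<Rightarrow> real^'n \<Rightarrow> real) \<Rightarrow> real^'m \<Rightarrow> real^'n \<Rightarrow> real^'m" where
  "Dx b x y = (\<chi> i. frechet_derivative (\<lambda>x'. b x' y) (at x) (axis i 1))"

definition Dy :: "(real^'m \<Rightarrow> real^'n \<Rightarrow> real) \<Rightarrow> real^'m \<Rightarrow> real^'n \<Rightarrow> real^'n" where
  "Dy b x y = (\<chi> j. frechet_derivative (\<lambda>y'. b x y') (at y) (axis j 1))"

(* The matrix with m rows and n columns whose (i,j) entry is the mixed partial derivative of b
   in x_i and y_j. *)
definition D2xy :: "(real^'m \<Rightarrow> real^'n \<Rightarrow> real) \<Rightarrow> real^'m \<Rightarrow> real^'n \<Rightarrow> real^'n^'m" where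
  "D2xy b x y = (\<chi> i j. frechet_derivative (\<lambda>x'. Dy b x' y $ j) (at x) (axis i 1))"

definition b_convex ::
  "(real^'m \<Rightarrow> real^'n \<Rightarrow> real) \<Rightarrow> (real^'m) set \<Rightarrow> (real^'n) set \<Rightarrow> bool" where
  "b_convex b X Y \<longleftrightarrow> (\<forall>y\<^sub>0\<in>closure Y. convex ((\<lambda>x. Dy b x y\<^sub>0) ` closure X))"

definition Lset ::
  "(real^'m \<Rightarrow> real^'n \<Rightarrow> real) \<Rightarrow> (real^'n) set \<Rightarrow> real^'n \<Rightarrow> real^'m \<Rightarrow> (real^'n) set" where
  "Lset b Y y x = {y' \<in> closure Y. Dx b x y' = Dx b x y}"

definition eff_goods ::
  "(real^'m \<Rightarrow> real^'n \<Rightarrow> real) \<Rightarrow> (real^'n) set \<Rightarrow> real^'m \<Rightarrow> (real^'m) set" where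
  "eff_goods b Y x\<^sub>0 = Dx b x\<^sub>0 ` closure Y"

(* The common value of b x y - b x0 y over all y in the fibre of w; only meaningful where this
   value does not depend on y. *)
definition eff_pref ::
  "(real^'m \<Rightarrow> real^'n \<Rightarrow> real) \<Rightarrow> (real^'n) set \<Rightarrow> real^'m \<Rightarrow> real^'m \<Rightarrow> real^'m \<Rightarrow> real" where
  "eff_pref b Y x\<^sub>0 x w = (THE r. \<forall>y\<in>closure Y. Dx b x\<^sub>0 y = w \<longrightarrow> r = b x y - b x\<^sub>0 y)"

definition eff_cost ::
  "(real^'m \<Rightarrow> real^'n \<Rightarrow> real) \<Rightarrow> (real^'n) set \<Rightarrow> (real^'n \<Rightarrow> real) \<Rightarrow> real^'m \<Rightarrow> real^'m \<Rightarrow> real"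
  where "eff_cost b Y c x\<^sub>0 w = (INF y\<in>{y \<in> closure Y. Dx b x\<^sub>0 y = w}. c y - b x\<^sub>0 y)"

(* Integrals with values in [-infinity, infinity]: defined when f is measurable and the positive
   or the negative part of f has finite integral. ennreal truncates negative reals to 0, so the
   two nonnegative integrals are those of the positive and of the negative part. *)
definition ext_integral_defined :: "'a measure \<Rightarrow> ('a \<Rightarrow> real) \<Rightarrow> bool" where
  "ext_integral_defined M f \<longleftrightarrow> f \<in> borel_measurable M \<and>
     ((\<integral>\<^sup>+ x. ennreal (f x) \<partial>M) < \<infinity> \<or> (\<integral>\<^sup>+ x. ennreal (- f x) \<partial>M) < \<infinity>)"

definition ext_integral :: "'a measure \<Rightarrow> ('a \<Rightarrow> real) \<Rightarrow> ereal" where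
  "ext_integral M f =
     enn2ereal (\<integral>\<^sup>+ x. ennreal (f x) \<partial>M) - enn2ereal (\<integral>\<^sup>+ x. ennreal (- f x) \<partial>M)"

(* The original and the effective problem have the same shape and are both instances of the
   following: goods z in Z, preferences f x z of type x in space M, production cost k z. The
   instances are (b, closure Y, c) and (h, W, g). *)

definition utility :: "('x \<Rightarrow> 'z \<Rightarrow> real) \<Rightarrow> 'z set \<Rightarrow> ('z \<Rightarrow> ereal) \<Rightarrow> 'x \<Rightarrow> ereal" where
  "utility f Z v x = (SUP z\<in>Z. ereal (f x z) - v z)"

definition profit_at ::
  "('x \<Rightarrow> 'z \<Rightarrow> real) \<Rightarrow> 'z set \<Rightarrow> ('z \<Rightarrow> real) \<Rightarrow> ('z \<Rightarrow> ereal) \<Rightarrow> ('x \<Rightarrow> 'z) \<Rightarrow> 'x \<Rightarrow> real" where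
  "profit_at f Z k v s x = f x (s x) - real_of_ereal (utility f Z v x) - k (s x)"

definition profit ::
  "'x measure \<Rightarrow> ('x \<Rightarrow> 'z \<Rightarrow> real) \<Rightarrow> 'z set \<Rightarrow> ('z \<Rightarrow> real) \<Rightarrow> ('z \<Rightarrow> ereal) \<times> ('x \<Rightarrow> 'z) \<Rightarrow> ereal"
  where "profit M f Z k = (\<lambda>(v, s). ext_integral M (profit_at f Z k v s))"

(* Pairs (v, s) of a price schedule v with values in the reals and +infinity, whose utility is
   finite and at least u0 (participation), and a choice function s, the maximizers being
   required almost everywhere; the profit integral must be defined. *)
definition offers ::
  "'x measure \<Rightarrow> ('x \<Rightarrow> real) \<Rightarrow> ('x \<Rightarrow> 'z \<Rightarrow> real) \<Rightarrow> 'z set \<Rightarrow> ('z \<Rightarrow> real)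
     \<Rightarrow> (('z \<Rightarrow> ereal) \<times> ('x \<Rightarrow> 'z)) set" where
  "offers M u\<^sub>0 f Z k = {(v, s).
     (\<forall>z\<in>Z. v z \<noteq> -\<infinity>) \<and>
     (\<forall>x\<in>space M. \<bar>utility f Z v x\<bar> \<noteq> \<infinity> \<and> ereal (u\<^sub>0 x) \<le> utility f Z v x) \<and>
     (\<forall>x\<in>space M. s x \<in> Z) \<and>
     (AE x in M. is_arg_max (\<lambda>z. ereal (f x z) - v z) (\<lambda>z. z \<in> Z) (s x)) \<and>
     ext_integral_defined M (profit_at f Z k v s)}"

definition max_profit ::
  "'x measure \<Rightarrow> ('x \<Rightarrow> real) \<Rightarrow> ('x \<Rightarrow> 'z \<Rightarrow> real) \<Rightarrow> 'z set \<Rightarrow> ('z \<Rightarrow> real) \<Rightarrow> ereal" where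
  "max_profit M u\<^sub>0 f Z k = (SUP a\<in>offers M u\<^sub>0 f Z k. profit M f Z k a)"

(* A maximizer attains the supremum with a finite profit. Functions u are compared with
   utilities on space M only. *)
definition optimal_utility ::
  "'x measure \<Rightarrow> ('x \<Rightarrow> real) \<Rightarrow> ('x \<Rightarrow> 'z \<Rightarrow> real) \<Rightarrow> 'z set \<Rightarrow> ('z \<Rightarrow> real) \<Rightarrow> ('x \<Rightarrow> real) \<Rightarrow> bool"
  where "optimal_utility M u\<^sub>0 f Z k u \<longleftrightarrow>
     (\<exists>(v, s)\<in>offers M u\<^sub>0 f Z k.
        profit M f Z k (v, s) = max_profit M u\<^sub>0 f Z k \<and>
        \<bar>profit M f Z k (v, s)\<bar> \<noteq> \<infinity> \<and>
        (\<forall>x\<in>space M. utility f Z v x = ereal (u x)))"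

end

(* Two goods with the same marginal preference at one type are worth the same to every type up to a
   constant, so a price schedule v induces the effective schedule p(w) = inf (v(y) - b(x0,y)) with
   the same utility; conversely effective schedules lift to schedules, the cheapest good of each
   fibre being produced. The first reduction does not decrease the profit pointwise, but since c is
   arbitrary it may destroy the measurability of the profit. This is repaired by approximating
   the new profit with finite menus, in which a small discount proportional to the margin keeps
   types from moving to less profitable goods. *)
theory Submission
  imports Defs
begin

text \<open>The reduced offer earns its profit through \<open>g (Q (s x))\<close>; as
  \<open>c\<close> has no regularity, it may fall outside \<open>offers\<close>, so the two suprema
  cannot be compared offer by offer. The remedy rests on the continuity of \<open>h x\<close> on the
  effective goods, which comes from the compactness of \<open>closure Y\<close>. Prices and costs
  need not be continuous, so goods are sampled jointly with their price and cost. If sampling shifts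
  values by \<delta>, a type may switch to an item whose margin is lower by the order of \<delta>
  divided by the discount rate \<tau>. Hence the sampling error has to vanish first, with \<tau>
  fixed, and only then \<tau>. The outcome is a measurable majorant \<open>L\<close> of the profit
  and not just a bound on its integral: when the maximum is attained with a finite value,
  \<open>L\<close> and the original profit have equal integrals and squeeze the reduced profit
  between them, which makes it measurable up to a null set.\<close>

section \<open>Integrating a vanishing derivative over a set with a convex image\<close>

text \<open>Turns local injectivity into global injectivity: level sets are connected by hypothesis,
  and the rank condition isolates each point in its level set.\<close>

lemma connected_isolated_point:
  fixes S :: "'a::metric_space set"
  assumes "connected S" "p \<in> S" "x \<in> S" "d > 0" "\<And>y. y \<in> S \<Longrightarrow> dist y p < d \<Longrightarrow> y = p"
  shows "x = p"
proof (rule ccontr)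
  assume "x \<noteq> p"
  then have "p islimpt S"
    using assms(1-3) by (intro connected_imp_perfect) auto
  then show False
    using assms(4,5) unfolding islimpt_approachable by blast
qed

text \<open>As \<open>K\<close> is compact, \<open>\<phi>\<close> is a homeomorphism onto a convex
  set, and a segment there pulls back to a curve in \<open>K\<close>. The curve need not be
  differentiable, but at each of its points \<open>expand\<close> bounds its increments by a
  multiple of those of the segment. Since the derivative of \<open>f\<close> vanishes, this is
  enough for \<open>f\<close> to have derivative zero along the curve.\<close>

lemma constant_on_of_zero_derivative:
  fixes \<phi> :: "'a::euclidean_space \<Rightarrow> 'b::euclidean_space" and f :: "'a \<Rightarrow> real"
  assumes K: "compact K" and cont: "continuous_on K \<phi>" and inj: "inj_on \<phi> K"
    and conv: "convex (\<phi> ` K)"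
    and expand: "\<And>p. p \<in> K \<Longrightarrow> \<exists>B>0. \<exists>d>0. \<forall>x\<in>K. norm (x - p) < d \<longrightarrow>
                    B * norm (x - p) \<le> norm (\<phi> x - \<phi> p)"
    and f: "\<And>p. p \<in> K \<Longrightarrow> (f has_derivative (\<lambda>_. 0)) (at p within K)"
    and xy: "x \<in> K" "y \<in> K"
  shows "f x = f y"
proof -
  define \<psi> where "\<psi> = the_inv_into K \<phi>"
  have \<psi>: "\<psi> (\<phi> z) = z" if "z \<in> K" for z
    using inj that by (simp add: \<psi>_def the_inv_into_f_f)
  have \<psi>': "\<psi> q \<in> K \<and> \<phi> (\<psi> q) = q" if "q \<in> \<phi> ` K" for q
    using that \<psi> by auto
  have cont\<psi>: "continuous_on (\<phi> ` K) \<psi>"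
    using cont K \<psi> by (intro continuous_on_inv) auto
  define l where "l = linepath (\<phi> x) (\<phi> y)"
  have l: "l t \<in> \<phi> ` K" if "t \<in> {0..1}" for t
    using that conv xy unfolding l_def linepath_def by (auto simp: convex_alt)
  define \<gamma> where "\<gamma> = \<psi> \<circ> l"
  have contl: "continuous_on {0..1} l"
    unfolding l_def by (rule continuous_on_linepath)
  have cont\<gamma>: "continuous_on {0..1} \<gamma>"
    unfolding \<gamma>_def using contl cont\<psi> l
    by (metis continuous_on_compose continuous_on_subset image_subset_iff)
  have \<gamma>: "\<gamma> t \<in> K" "\<phi> (\<gamma> t) = l t" if "t \<in> {0..1}" for t
    using \<psi>'[OF l[OF that]] by (auto simp: \<gamma>_def)
  have "(f \<circ> \<gamma> has_derivative (\<lambda>_. 0)) (at t within {0..1})" if t: "t \<in> {0..1}" for t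
    unfolding has_derivative_within_alt
  proof (intro conjI allI impI)
    show "bounded_linear (\<lambda>_::real. 0::real)" by simp
    fix e :: real assume e: "e > 0"
    obtain B d1 where B: "B > 0" "d1 > 0"
      "\<And>x. x \<in> K \<Longrightarrow> norm (x - \<gamma> t) < d1 \<Longrightarrow> B * norm (x - \<gamma> t) \<le> norm (\<phi> x - \<phi> (\<gamma> t))"
      using expand[OF \<gamma>(1)[OF t]] by blast
    \<comment> \<open>The curve moves by at most \<open>C / B\<close> times the change of the
      parameter, whence the choice of \<open>e'\<close>. The summand 1 keeps \<open>C\<close>
      positive when the segment is degenerate.\<close>
    define C where "C = norm (\<phi> y - \<phi> x) + 1"
    have C: "C > 0" "norm (\<phi> y - \<phi> x) \<le> C" unfolding C_def by (auto intro: add_nonneg_pos)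
    define e' where "e' = e * B / C"
    have e': "e' > 0" using e B C by (simp add: e'_def)
    obtain d2 where d2: "d2 > 0"
      "\<And>x. x \<in> K \<Longrightarrow> norm (x - \<gamma> t) < d2 \<Longrightarrow> norm (f x - f (\<gamma> t)) \<le> e' * norm (x - \<gamma> t)"
      using f[OF \<gamma>(1)[OF t]] e' unfolding has_derivative_within_alt by auto
    obtain d3 where d3: "d3 > 0"
      "\<And>s. s \<in> {0..1} \<Longrightarrow> dist s t < d3 \<Longrightarrow> dist (\<gamma> s) (\<gamma> t) < min d1 d2"
      using cont\<gamma> t B(2) d2(1) unfolding continuous_on_iff by (metis min_less_iff_conj)
    show "\<exists>d>0. \<forall>s\<in>{0..1}. norm (s - t) < d \<longrightarrow>
            norm ((f \<circ> \<gamma>) s - (f \<circ> \<gamma>) t - 0) \<le> e * norm (s - t)"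
    proof (intro exI[of _ d3] conjI ballI impI)
      fix s :: real assume s: "s \<in> {0..1}" "norm (s - t) < d3"
      have cl: "norm (\<gamma> s - \<gamma> t) < min d1 d2"
        using d3(2)[OF s(1)] s(2) by (simp add: dist_norm)
      have "l s - l t = (s - t) *\<^sub>R (\<phi> y - \<phi> x)"
        by (simp add: l_def linepath_def algebra_simps)
      then have "B * norm (\<gamma> s - \<gamma> t) \<le> \<bar>s - t\<bar> * C"
        using B(3)[OF \<gamma>(1)[OF s(1)]] cl \<gamma>(2)[OF s(1)] \<gamma>(2)[OF t] C(2)
        by (smt (verit) abs_ge_zero mult_left_mono norm_scaleR)
      then have *: "e / C * (B * norm (\<gamma> s - \<gamma> t)) \<le> e / C * (\<bar>s - t\<bar> * C)"
        using e C by (intro mult_left_mono) auto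
      have "norm (f (\<gamma> s) - f (\<gamma> t)) \<le> e' * norm (\<gamma> s - \<gamma> t)"
        using d2(2)[OF \<gamma>(1)[OF s(1)]] cl by simp
      also have "\<dots> \<le> e * \<bar>s - t\<bar>"
        using * C by (simp add: e'_def field_simps)
      finally show "norm ((f \<circ> \<gamma>) s - (f \<circ> \<gamma>) t - 0) \<le> e * norm (s - t)" by simp
    qed (fact d3(1))
  qed
  then obtain k where k: "\<forall>t\<in>{0..1}. (f \<circ> \<gamma>) t = k"
    using has_derivative_zero_constant[of "{0..1::real}" "f \<circ> \<gamma>"] by auto
  have "\<gamma> 0 = x" "\<gamma> 1 = y"
    using \<psi> xy by (auto simp: \<gamma>_def l_def linepath_def)
  then show ?thesis using k by (metis atLeastAtMost_iff comp_apply le_numeral_extra(3,4) zero_le_one)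
qed

section \<open>Partial derivatives of a jointly smooth function\<close>

lemma Ck_on_continuous: "Ck_on k U f \<Longrightarrow> continuous_on U f"
proof (cases k)
  case (Suc j)
  assume "Ck_on k U f"
  then have "f differentiable at z" if "z \<in> U" for z using Suc that by simp
  then show ?thesis
    by (simp add: continuous_at_imp_continuous_on differentiable_imp_continuous_within)
qed simp

lemma Ck_on_Suc: "Ck_on (Suc k) U f \<Longrightarrow> Ck_on k U f"
proof (induction k arbitrary: f)
  case 0
  show ?case using Ck_on_continuous[OF 0] by simp
next
  case (Suc k)
  have "Ck_on k U (\<lambda>z. frechet_derivative f (at z) e)" for e
    using Suc.prems Ck_on.simps(2)[of "Suc k" U f] by (intro Suc.IH) blast
  then show ?case using Suc.prems by (simp only: Ck_on.simps) blast
qed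

lemma partial_derivative_fst:
  fixes F :: "'a::euclidean_space \<times> 'b::euclidean_space \<Rightarrow> real"
  assumes "F differentiable at (x, y)"
  shows "((\<lambda>x'. F (x', y)) has_derivative (\<lambda>d. frechet_derivative F (at (x, y)) (d, 0))) (at x)"
proof -
  have "(F has_derivative frechet_derivative F (at (x, y))) (at (x, y))"
    using assms frechet_derivative_works by blast
  moreover have "((\<lambda>x'. (x', y)) has_derivative (\<lambda>d. (d, 0))) (at x)"
    by (auto intro!: derivative_eq_intros)
  ultimately show ?thesis
    using has_derivative_compose[of "\<lambda>x'. (x', y)"] by fastforce
qed

lemma partial_derivative_snd:
  fixes F :: "'a::euclidean_space \<times> 'b::euclidean_space \<Rightarrow> real"
  assumes "F differentiable at (x, y)"
  shows "((\<lambda>y'. F (x, y')) has_derivative (\<lambda>d. frechet_derivative F (at (x, y)) (0, d))) (at y)"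
proof -
  have "(F has_derivative frechet_derivative F (at (x, y))) (at (x, y))"
    using assms frechet_derivative_works by blast
  moreover have "((\<lambda>y'. (x, y')) has_derivative (\<lambda>d. (0, d))) (at y)"
    by (auto intro!: derivative_eq_intros)
  ultimately show ?thesis
    using has_derivative_compose[of "\<lambda>y'. (x, y')"] by fastforce
qed

text \<open>Smoothness is assumed of \<open>b\<close> as a function of the pair; the partial
  gradient inherits it through this expression by the joint derivative.\<close>

lemma Dx_eq:
  assumes "(\<lambda>(x, y). b x y) differentiable at (x, y)"
  shows "Dx b x y = (\<chi> i. frechet_derivative (\<lambda>(x, y). b x y) (at (x, y)) (axis i 1, 0))"
  using frechet_derivative_at[OF partial_derivative_fst[OF assms], symmetric]
  by (simp add: Dx_def vec_eq_iff)

lemma Dy_eq: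
  assumes "(\<lambda>(x, y). b x y) differentiable at (x, y)"
  shows "Dy b x y = (\<chi> j. frechet_derivative (\<lambda>(x, y). b x y) (at (x, y)) (0, axis j 1))"
  using frechet_derivative_at[OF partial_derivative_snd[OF assms], symmetric]
  by (simp add: Dy_def vec_eq_iff)

lemma vec_cart_expansion: "(d :: real^'m) = (\<Sum>i\<in>UNIV. (d $ i) *\<^sub>R axis i 1)"
  using basis_expansion[of d] by (simp add: scalar_mult_eq_scaleR)

lemma linear_cart_expansion:
  fixes f :: "real^'m \<Rightarrow> real"
  assumes "linear f"
  shows "f d = (\<Sum>i\<in>UNIV. d $ i * f (axis i 1))"
  by (subst vec_cart_expansion[of d]) (simp add: linear_sum[OF assms] linear_cmul[OF assms])

lemma fst_derivative_Dx:
  assumes "(\<lambda>(x, y). b x y) differentiable at (x, y)"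
  shows "((\<lambda>x'. b x' y) has_derivative (\<lambda>d. d \<bullet> Dx b x y)) (at x)"
proof -
  have D: "((\<lambda>x'. b x' y) has_derivative frechet_derivative (\<lambda>x'. b x' y) (at x)) (at x)"
    using partial_derivative_fst[OF assms] frechet_derivative_works differentiable_def by fastforce
  have "frechet_derivative (\<lambda>x'. b x' y) (at x) d = d \<bullet> Dx b x y" for d
    by (subst linear_cart_expansion[OF has_derivative_linear[OF D]]) (simp add: Dx_def inner_vec_def)
  then show ?thesis using D by presburger
qed

lemma Dy_has_derivative:
  fixes b :: "real^'m \<Rightarrow> real^'n \<Rightarrow> real"
  assumes U: "open U" "(x, y) \<in> U" and F: "Ck_on 2 U (\<lambda>(x, y). b x y)"
  shows "((\<lambda>x'. Dy b x' y) has_derivative (\<lambda>d. transpose (D2xy b x y) *v d)) (at x)"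
proof -
  let ?F = "\<lambda>(x, y). b x y"
  have dF: "?F differentiable at z" if "z \<in> U" for z
    using F that by (simp add: eval_nat_numeral)
  \<comment> \<open>The slice of \<open>U\<close> at \<open>y\<close> is a neighbourhood of
    \<open>x\<close> on which \<open>Dy\<close> coincides with components of the joint derivative;
    outside it nothing is known about \<open>Dy\<close>.\<close>
  define V where "V = (\<lambda>x'. (x', y)) -` U"
  have V: "open V" "x \<in> V"
    unfolding V_def using U by (auto intro!: open_vimage continuous_intros)
  have D: "((\<lambda>x'. Dy b x' y $ j) has_derivative (\<lambda>d. (transpose (D2xy b x y) *v d) $ j)) (at x)" for j
  proof -
    have "(\<lambda>z. frechet_derivative ?F (at z) (0, axis j 1)) differentiable at (x, y)"
      using F U by (simp add: eval_nat_numeral)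
    from partial_derivative_fst[OF this]
    obtain D where "((\<lambda>x'. frechet_derivative ?F (at (x', y)) (0, axis j 1)) has_derivative D) (at x)"
      by blast
    then have D: "((\<lambda>x'. Dy b x' y $ j) has_derivative D) (at x)"
      by (rule has_derivative_transform_within_open[OF _ V]) (simp add: V_def Dy_eq dF)
    have "D d = (transpose (D2xy b x y) *v d) $ j" for d
      by (subst linear_cart_expansion[OF has_derivative_linear[OF D]])
        (simp add: D2xy_def transpose_def matrix_vector_mult_def frechet_derivative_at[OF D, symmetric]
           mult.commute)
    then show ?thesis using D by presburger
  qed
  show ?thesis
    by (subst has_derivative_componentwise_within)
      (use D in \<open>auto simp: Basis_vec_def inner_axis\<close>)
qed

section \<open>Constancy of preference differences on a fibre\<close>

text \<open>An injective linear map is bounded below by some \<open>B > 0\<close>, and close to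
  \<open>p\<close> the remainder consumes at most half of it. The target may have larger dimension,
  as it does here, so this replaces an appeal to the inverse function theorem.\<close>

lemma has_derivative_inj_expanding:
  fixes f :: "'a::euclidean_space \<Rightarrow> 'b::euclidean_space"
  assumes f: "(f has_derivative f') (at p)" and inj: "inj f'"
  shows "\<exists>B>0. \<exists>d>0. \<forall>x. norm (x - p) < d \<longrightarrow> B * norm (x - p) \<le> norm (f x - f p)"
proof -
  obtain B where B: "B > 0" "\<And>x. B * norm x \<le> norm (f' x)"
    using linear_inj_bounded_below_pos[OF has_derivative_linear[OF f] inj] by blast
  obtain d where d: "d > 0" "\<And>x. norm (x - p) < d \<Longrightarrow> norm (f x - f p - f' (x - p)) \<le> B / 2 * norm (x - p)"
    using f B(1) unfolding has_derivative_at_alt by (meson half_gt_zero)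
  have "B / 2 * norm (x - p) \<le> norm (f x - f p)" if "norm (x - p) < d" for x
    using d(2)[OF that] B(2)[of "x - p"] norm_triangle_ineq3[of "f x - f p" "f' (x - p)"]
    by (simp add: field_simps)
  then show ?thesis using B(1) d(1) by (metis half_gt_zero)
qed

text \<open>As the closure of X need not a priori be connected by rectifiable paths, the vanishing gradient
  is integrated along the preimages of segments under the injective immersion \<open>x \<mapsto> D\<^sub>yb(x, y)\<close>,
  whose image is convex.\<close>
lemma preference_difference_constant:
  fixes X :: "(real^'m) set" and Y :: "(real^'n) set"
  assumes dims: "CARD('n) > CARD('m)"
    and X: "bounded X" and U: "open U" "closure X \<times> closure Y \<subseteq> U"
    and F: "Ck_on 2 U (\<lambda>(x, y). b x y)"
    and levels_x: "\<And>y q. y \<in> closure Y \<Longrightarrow> connected {x \<in> closure X. Dy b x y = q}"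
    and full_rank: "\<And>x y. x \<in> closure X \<Longrightarrow> y \<in> closure Y \<Longrightarrow>
          rank (D2xy b x y) = min CARD('m) CARD('n)"
    and X_b_convex: "b_convex b X Y"
    and y: "y \<in> closure Y" "y' \<in> closure Y" 
    and eq: "\<And>x. x \<in> closure X \<Longrightarrow> Dx b x y = Dx b x y'"
    and x: "x \<in> closure X" "x' \<in> closure X"
  shows "b x y - b x y' = b x' y - b x' y'"
proof -
  have D: "((\<lambda>x'. Dy b x' y) has_derivative (\<lambda>d. transpose (D2xy b x y) *v d)) (at x)"
    if "x \<in> closure X" for x
    using Dy_has_derivative[OF U(1) _ F] U(2) that y by blast
  have ex: "\<exists>B>0. \<exists>d>0. \<forall>x. norm (x - p) < d \<longrightarrow> B * norm (x - p) \<le> norm (Dy b x y - Dy b p y)"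
    if "p \<in> closure X" for p
  proof (rule has_derivative_inj_expanding[OF D[OF that]])
    \<comment> \<open>As n > m, full rank means rank m, which is the number of columns of the
      transpose; so the transpose acts injectively.\<close>
    have "rank (transpose (D2xy b p y)) = CARD('m)"
      using full_rank[OF that y(1)] dims by (simp add: rank_transpose)
    then show "inj ((*v) (transpose (D2xy b p y)))" by (simp add: full_rank_injective)
  qed
  have inj: "inj_on (\<lambda>x. Dy b x y) (closure X)"
  proof (rule inj_onI)
    fix p z assume p: "p \<in> closure X" "z \<in> closure X" "Dy b p y = Dy b z y"
    obtain B d where "B > 0" "d > 0"
      and B: "\<And>x. norm (x - z) < d \<Longrightarrow> B * norm (x - z) \<le> norm (Dy b x y - Dy b z y)"
      using ex[OF p(2)] by blast
    show "p = z"
    proof (rule connected_isolated_point[OF levels_x[OF y(1), of "Dy b z y"] _ _ \<open>d > 0\<close>])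
      fix x assume "x \<in> {x \<in> closure X. Dy b x y = Dy b z y}" "dist x z < d"
      then have "B * norm (x - z) \<le> 0" using B[of x] by (simp add: dist_norm)
      then show "x = z" using \<open>B > 0\<close> by (simp add: mult_le_0_iff)
    qed (use p in auto)
  qed
  show ?thesis
  proof (rule constant_on_of_zero_derivative[of "closure X" "\<lambda>x. Dy b x y", OF _ _ inj _ _ _ x])
    show "compact (closure X)" using X by simp
    show "continuous_on (closure X) (\<lambda>x. Dy b x y)"
      by (intro continuous_at_imp_continuous_on ballI has_derivative_continuous[OF D])
    show "convex ((\<lambda>x. Dy b x y) ` closure X)"
      using X_b_convex y by (simp add: b_convex_def)
    fix p assume p: "p \<in> closure X"
    show "\<exists>B>0. \<exists>d>0. \<forall>x\<in>closure X. norm (x - p) < d \<longrightarrow>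
        B * norm (x - p) \<le> norm (Dy b x y - Dy b p y)"
      using ex[OF p] by blast
    have "(\<lambda>(x, y). b x y) differentiable at z" if "z \<in> closure X \<times> closure Y" for z
      using F U(2) that by (auto simp: eval_nat_numeral)
    then have "((\<lambda>x. b x y - b x y') has_derivative (\<lambda>d. d \<bullet> Dx b p y - d \<bullet> Dx b p y')) (at p)"
      using p y by (intro has_derivative_diff fst_derivative_Dx) auto
    then show "((\<lambda>x. b x y - b x y') has_derivative (\<lambda>_. 0)) (at p within closure X)"
      using eq[OF p] by (simp add: has_derivative_at_withinI)
  qed
qed

section \<open>Continuity of the effective preference in the effective good\<close>

lemma continuous_on_Dx:
  fixes b :: "real^'m \<Rightarrow> real^'n \<Rightarrow> real"
  assumes U: "{x} \<times> S \<subseteq> U" and F: "Ck_on 2 U (\<lambda>(x, y). b x y)"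
  shows "continuous_on S (Dx b x)"
proof -
  let ?F = "\<lambda>(x, y). b x y"
  have eq: "Dx b x y = (\<chi> i. frechet_derivative ?F (at (x, y)) (axis i 1, 0))" if "y \<in> S" for y
    using F U that by (intro Dx_eq) (auto simp: eval_nat_numeral)
  have "continuous_on U (\<lambda>z. frechet_derivative ?F (at z) (axis i 1, 0))" for i
    using F by (intro Ck_on_continuous[of 1]) (simp add: eval_nat_numeral)
  then have "continuous_on S (\<lambda>y. frechet_derivative ?F (at (x, y)) (axis i 1, 0))" for i
    by (rule continuous_on_compose2[where f = "Pair x"]) (use U in \<open>auto intro!: continuous_intros\<close>)
  then have "continuous_on S (\<lambda>y. \<chi> i. frechet_derivative ?F (at (x, y)) (axis i 1, 0))"
    by (intro continuous_intros)
  then show ?thesis using eq by (simp cong: continuous_on_cong)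
qed

text \<open>A continuous map from a compact space to a Hausdorff space is closed, hence a quotient
  map onto its image: the preimage of a closed set under \<open>h\<close> is the
  \<open>Q\<close>-image of a compact set.\<close>

lemma continuous_on_factor:
  fixes Q :: "'a::topological_space \<Rightarrow> 'b::t2_space" and h :: "'b \<Rightarrow> 'c::topological_space"
  assumes K: "compact K" and Q: "continuous_on K Q" and hQ: "continuous_on K (h \<circ> Q)"
  shows "continuous_on (Q ` K) h"
proof -
  have "closed (h -` B \<inter> Q ` K)" if "closed B" for B
  proof -
    have "h -` B \<inter> Q ` K = Q ` (K \<inter> (h \<circ> Q) -` B)" by auto
    moreover obtain C where "closed C" "C \<inter> K = (h \<circ> Q) -` B \<inter> K"
      using hQ \<open>closed B\<close> unfolding continuous_on_closed_invariant by blast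
    then have "compact (K \<inter> (h \<circ> Q) -` B)"
      using K by (metis compact_Int_closed Int_commute)
    ultimately show ?thesis
      using Q by (metis compact_continuous_image compact_imp_closed continuous_on_subset inf_le1)
  qed
  moreover have "closed (Q ` K)"
    using compact_continuous_image[OF Q K] by (rule compact_imp_closed)
  ultimately show ?thesis by (simp add: continuous_on_closed_vimage)
qed

section \<open>Utilities and finite menus\<close>

lemma is_arg_max_utility_iff:
  assumes "z \<in> Z"
  shows "is_arg_max (\<lambda>z. ereal (f x z) - v z) (\<lambda>z. z \<in> Z) z \<longleftrightarrow>
    utility f Z v x \<le> ereal (f x z) - v z"
  using assms unfolding is_arg_max_def utility_def by (auto simp: SUP_le_iff not_less)

lemma utility_ge: "z \<in> Z \<Longrightarrow> ereal (f x z) - v z \<le> utility f Z v x"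
  unfolding utility_def by (rule SUP_upper)

text \<open>The supremum may run over uncountably many goods, but its strict superlevel sets are
  unions of open sets, whatever the price schedule is.\<close>

lemma borel_measurable_utility:
  fixes M :: "'a::topological_space measure"
  assumes X: "open (space M)" "\<And>S. open S \<Longrightarrow> S \<subseteq> space M \<Longrightarrow> S \<in> sets M"
    and f: "\<And>z. z \<in> Z \<Longrightarrow> continuous_on (space M) (\<lambda>x. f x z)"
  shows "(\<lambda>x. utility f Z v x) \<in> borel_measurable M"
proof (rule borel_measurableI_greater)
  fix a
  have "open ((\<lambda>x. ereal (f x z) - v z) -` {a<..} \<inter> space M)" if "z \<in> Z" for z
  proof -
    have "continuous_on (space M) (\<lambda>x. ereal (f x z) - v z)"
    proof (cases "v z")
      case (real r)
      have "continuous_on (space M) (\<lambda>x. ereal (f x z - r))"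
        by (intro continuous_on_ereal continuous_intros f that)
      then show ?thesis using real by simp
    qed simp_all
    then show ?thesis using X(1) continuous_on_open_vimage open_greaterThan by blast
  qed
  then have "open (\<Union>z\<in>Z. (\<lambda>x. ereal (f x z) - v z) -` {a<..} \<inter> space M)" by blast
  then have "(\<Union>z\<in>Z. (\<lambda>x. ereal (f x z) - v z) -` {a<..} \<inter> space M) \<in> sets M"
    by (rule X(2)) auto
  also have "(\<Union>z\<in>Z. (\<lambda>x. ereal (f x z) - v z) -` {a<..} \<inter> space M) =
      {x \<in> space M. a < utility f Z v x}"
    by (auto simp: utility_def less_SUP_iff)
  finally show "{x \<in> space M. a < utility f Z v x} \<in> sets M" .
qed

text \<open>Finite menus are the source of offers with a measurable profit: breaking ties by the
  least index makes the choice measurable, and a function of finitely many indices is then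
  measurable without any regularity of \<open>k\<close>. Nonnegative margins make the negative part
  vanish, so the integral is defined.\<close>

lemma finite_menu_profit:
  fixes f :: "'x \<Rightarrow> 'z \<Rightarrow> real" and z :: "nat \<Rightarrow> 'z" and q :: "nat \<Rightarrow> real"
  assumes z: "\<And>i. i \<le> n \<Longrightarrow> z i \<in> Z"
    and meas: "\<And>i. i \<le> n \<Longrightarrow> (\<lambda>x. f x (z i)) \<in> borel_measurable M"
    and part: "\<And>x. x \<in> space M \<Longrightarrow> \<exists>i\<le>n. u\<^sub>0 x \<le> f x (z i) - q i"
    and margin: "\<And>i. i \<le> n \<Longrightarrow> k (z i) \<le> q i"
  obtains j :: "'x \<Rightarrow> nat" where "\<And>x. j x \<le> n"
    "\<And>x i. i \<le> n \<Longrightarrow> f x (z i) - q i \<le> f x (z (j x)) - q (j x)"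
    "j \<in> M \<rightarrow>\<^sub>M count_space UNIV"
    "enn2ereal (\<integral>\<^sup>+x. ennreal (q (j x) - k (z (j x))) \<partial>M) \<le> max_profit M u\<^sub>0 f Z k"
proof -
  define j where "j x = (LEAST i. i \<le> n \<and> (\<forall>i'\<in>{..n}. f x (z i') - q i' \<le> f x (z i) - q i))" for x
  have ex: "\<exists>i. i \<le> n \<and> (\<forall>i'\<in>{..n}. f x (z i') - q i' \<le> f x (z i) - q i)" for x
  proof -
    obtain i where "is_arg_min (\<lambda>i. - (f x (z i) - q i)) (\<lambda>i. i \<in> {..n}) i"
      using ex_is_arg_min_if_finite[of "{..n}"] by blast
    then have "i \<le> n \<and> (\<forall>i'\<in>{..n}. f x (z i') - q i' \<le> f x (z i) - q i)"
      unfolding is_arg_min_linorder by force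
    then show ?thesis ..
  qed
  have j: "j x \<le> n" "\<And>i. i \<le> n \<Longrightarrow> f x (z i) - q i \<le> f x (z (j x)) - q (j x)" for x
    using LeastI_ex[OF ex[of x]] unfolding j_def by auto
  have meas_j: "j \<in> M \<rightarrow>\<^sub>M count_space UNIV"
    unfolding j_def
  proof (rule measurable_Least)
    fix i
    show "Measurable.pred M (\<lambda>x. i \<le> n \<and> (\<forall>i'\<in>{..n}. f x (z i') - q i' \<le> f x (z i) - q i))"
    proof (cases "i \<le> n")
      case True
      note [measurable] = meas[OF True]
      have "Measurable.pred M (\<lambda>x. f x (z i') - q i' \<le> f x (z i) - q i)" if "i' \<in> {..n}" for i'
      proof -
        have [measurable]: "(\<lambda>x. f x (z i')) \<in> borel_measurable M" using meas that by simp
        show ?thesis by measurable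
      qed
      then have "Measurable.pred M (\<lambda>x. \<forall>i'\<in>{..n}. f x (z i') - q i' \<le> f x (z i) - q i)"
        by (intro pred_intros_finite) auto
      then show ?thesis using True by simp
    qed simp
  qed
  \<comment> \<open>The same good may be listed at several prices, and the cheapest counts. For
    goods off the menu the infimum is over the empty set, which gives the price \<infinity>.\<close>
  define v :: "'z \<Rightarrow> ereal" where "v w = (INF i\<in>{i. i \<le> n \<and> z i = w}. ereal (q i))" for w
  have v_le: "v (z i) \<le> ereal (q i)" if "i \<le> n" for i
    unfolding v_def using that by (intro INF_lower) auto
  have v_ninf: "v w \<noteq> -\<infinity>" for w
  proof -
    have "ereal (Min (q ` {..n})) \<le> v w"
      unfolding v_def by (intro INF_greatest) auto
    then show ?thesis by auto
  qed
  have ub: "ereal (f x w) - v w \<le> ereal (f x (z (j x)) - q (j x))" for x w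
  proof -
    have "ereal (f x w - (f x (z (j x)) - q (j x))) \<le> v w"
      unfolding v_def
    proof (rule INF_greatest)
      fix i assume "i \<in> {i. i \<le> n \<and> z i = w}"
      then show "ereal (f x w - (f x (z (j x)) - q (j x))) \<le> ereal (q i)"
        using j(2)[of i x] by auto
    qed
    then show ?thesis using v_ninf[of w] by (cases "v w") auto
  qed
  have lb: "ereal (f x (z (j x)) - q (j x)) \<le> ereal (f x (z (j x))) - v (z (j x))" for x
    using v_le[OF j(1)[of x]] v_ninf[of "z (j x)"] by (cases "v (z (j x))") auto
  have util: "utility f Z v x = ereal (f x (z (j x)) - q (j x))" for x
    using ub lb[of x] utility_ge[OF z[OF j(1)[of x]], of f x v]
    by (intro antisym) (auto simp: utility_def SUP_le_iff intro: order_trans)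
  have pr: "profit_at f Z k v (\<lambda>x. z (j x)) = (\<lambda>x. q (j x) - k (z (j x)))"
    by (auto simp: profit_at_def util)
  have meas_pr: "(\<lambda>x. q (j x) - k (z (j x))) \<in> borel_measurable M"
    using meas_j by (rule measurable_compose) simp
  have neg: "(\<integral>\<^sup>+x. ennreal (- (q (j x) - k (z (j x)))) \<partial>M) = 0"
    using margin[OF j(1)] by (simp add: ennreal_neg)
  have "ereal (u\<^sub>0 x) \<le> utility f Z v x" if x: "x \<in> space M" for x
    using part[OF x] j(2)[of _ x] unfolding util by fastforce
  moreover have "is_arg_max (\<lambda>z. ereal (f x z) - v z) (\<lambda>z. z \<in> Z) (z (j x))" for x
    using lb[of x] z[OF j(1)] by (simp add: is_arg_max_utility_iff util)
  ultimately have "(v, \<lambda>x. z (j x)) \<in> offers M u\<^sub>0 f Z k"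
    using v_ninf z[OF j(1)] meas_pr neg
    by (auto simp: offers_def util pr ext_integral_defined_def)
  then have "profit M f Z k (v, \<lambda>x. z (j x)) \<le> max_profit M u\<^sub>0 f Z k"
    unfolding max_profit_def by (rule SUP_upper)
  then have "enn2ereal (\<integral>\<^sup>+x. ennreal (q (j x) - k (z (j x))) \<partial>M) \<le> max_profit M u\<^sub>0 f Z k"
    using neg by (simp add: profit_def pr ext_integral_def zero_ennreal.rep_eq)
  then show thesis using j meas_j that by blast
qed

section \<open>Measurable bounds for profits that need not be measurable\<close>

text \<open>A screening problem whose reservation utility comes from selling the good \<open>z\<^sub>\<phi>\<close> at a
  price \<open>q\<^sub>\<phi>\<close> that covers its cost.\<close>
locale screening =
  fixes M :: "'x measure" and u\<^sub>0 :: "'x \<Rightarrow> real" and f :: "'x \<Rightarrow> 'z::euclidean_space \<Rightarrow> real"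
    and Z :: "'z set" and k :: "'z \<Rightarrow> real" and z\<^sub>\<phi> :: 'z and q\<^sub>\<phi> :: real
  assumes meas: "\<And>z. z \<in> Z \<Longrightarrow> (\<lambda>x. f x z) \<in> borel_measurable M"
    and cont: "\<And>x. x \<in> space M \<Longrightarrow> continuous_on Z (f x)"
    and z_phi: "z\<^sub>\<phi> \<in> Z" and q_phi: "k z\<^sub>\<phi> \<le> q\<^sub>\<phi>"
    and reservation: "\<And>x. x \<in> space M \<Longrightarrow> u\<^sub>0 x = f x z\<^sub>\<phi> - q\<^sub>\<phi>"
begin

text \<open>The menu that lists only \<open>z\<^sub>\<phi>\<close> gives every type exactly the
  reservation utility and makes no loss. Consequently \<open>e2ennreal\<close>, which truncates at
  0, loses nothing when applied to the maximal profit.\<close>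

lemma max_profit_nonneg: "0 \<le> max_profit M u\<^sub>0 f Z k"
proof (rule finite_menu_profit[of 0 "\<lambda>_. z\<^sub>\<phi>" Z f M u\<^sub>0 "\<lambda>_. q\<^sub>\<phi>" k])
  fix j :: "'x \<Rightarrow> nat"
  assume "enn2ereal (\<integral>\<^sup>+x. ennreal (q\<^sub>\<phi> - k z\<^sub>\<phi>) \<partial>M) \<le> max_profit M u\<^sub>0 f Z k"
  then show ?thesis using enn2ereal_nonneg order_trans by blast
qed (auto simp: z_phi meas q_phi reservation)

text \<open>The profit of an arbitrary offer, which need not be measurable, is approached from below by
  finite menus. The menus run through a dense sequence of purchased goods together with their
  prices and costs, and the principal hands back the fraction \<open>\<tau>\<close> of the margin as a discount:
  a type that is nearly indifferent then moves to the items with the higher margin, so that its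
  margin cannot drop in the limit.\<close>
lemma discounted_profit_bound:
  assumes utility_finite: "\<And>x. x \<in> space M \<Longrightarrow> \<bar>utility f Z v x\<bar> \<noteq> \<infinity>"
    and participation: "\<And>x. x \<in> space M \<Longrightarrow> ereal (u\<^sub>0 x) \<le> utility f Z v x"
    and s: "\<And>x. x \<in> space M \<Longrightarrow> s x \<in> Z"
    and arg_max: "AE x in M. is_arg_max (\<lambda>z. ereal (f x z) - v z) (\<lambda>z. z \<in> Z) (s x)"
    and \<tau>: "0 < \<tau>" "\<tau> < 1"
  obtains L where "L \<in> borel_measurable M" "AE x in M. ennreal (profit_at f Z k v s x) \<le> L x"
    "ennreal (1 - \<tau>) * (\<integral>\<^sup>+x. L x \<partial>M) \<le> e2ennreal (max_profit M u\<^sub>0 f Z k)"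
proof -
  \<comment> \<open>Types that cause a loss are left out: \<open>ennreal\<close> truncates their
    profit to 0, and \<open>finite_menu_profit\<close> requires every sampled price to cover its
    cost.\<close>
  define G where "G = {x \<in> space M. is_arg_max (\<lambda>z. ereal (f x z) - v z) (\<lambda>z. z \<in> Z) (s x) \<and>
    0 \<le> profit_at f Z k v s x}"
  define r where "r z = real_of_ereal (v z)" for z
  define u where "u x = real_of_ereal (utility f Z v x)" for x
  have u: "utility f Z v x = ereal (u x)" if "x \<in> space M" for x
    using utility_finite[OF that] by (simp add: u_def ereal_real)
  have vs: "v (s x) = ereal (r (s x))" and us: "u x = f x (s x) - r (s x)" if "x \<in> G" for x
  proof -
    have x: "x \<in> space M" and "utility f Z v x \<le> ereal (f x (s x)) - v (s x)"
      using that s by (auto simp: G_def is_arg_max_utility_iff)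
    then have "ereal (f x (s x)) - v (s x) = ereal (u x)"
      using utility_ge[OF s[OF x], of f x v] u[OF x] by simp
    then show "v (s x) = ereal (r (s x))" "u x = f x (s x) - r (s x)"
      unfolding r_def by (cases "v (s x)"; simp)+
  qed
  have pr: "profit_at f Z k v s x = r (s x) - k (s x)" if "x \<in> G" for x
    using us[OF that] by (simp add: profit_at_def u_def)
  have u_ge: "f x (s x') - r (s x') \<le> u x" if "x \<in> space M" "x' \<in> G" for x x'
    using utility_ge[of "s x'" Z f x v] s that vs[OF that(2)] u[OF that(1)] by (auto simp: G_def)
  have u_phi: "f x z\<^sub>\<phi> - q\<^sub>\<phi> \<le> u x" if "x \<in> space M" for x
    using participation[OF that] reservation[OF that] u[OF that] by simp
  \<comment> \<open>\<open>r\<close> and \<open>k\<close> need not be continuous, so a dense set of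
    goods would not do. A dense part of the set of triples approximates good, price and cost
    simultaneously.\<close>
  obtain T where T: "countable T" "T \<subseteq> (\<lambda>x. (s x, r (s x), k (s x))) ` G"
    "(\<lambda>x. (s x, r (s x), k (s x))) ` G \<subseteq> closure T"
    using separable by blast
  \<comment> \<open>Index 0 puts \<open>z\<^sub>\<phi>\<close> on every menu, which secures
    participation. Inserting its triple into \<open>T\<close> as well keeps the enumerated set
    nonempty, as \<open>from_nat_into\<close> requires.\<close>
  define e where "e = case_nat (z\<^sub>\<phi>, q\<^sub>\<phi>, k z\<^sub>\<phi>) (from_nat_into (insert (z\<^sub>\<phi>, q\<^sub>\<phi>, k z\<^sub>\<phi>) T))"
  define z where "z i = fst (e i)" for i
  define p where "p i = fst (snd (e i))" for i
  have e_cases: "e i = (z\<^sub>\<phi>, q\<^sub>\<phi>, k z\<^sub>\<phi>) \<or> (\<exists>x\<in>G. e i = (s x, r (s x), k (s x)))" for i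
  proof (cases i)
    case (Suc i')
    then have "e i \<in> insert (z\<^sub>\<phi>, q\<^sub>\<phi>, k z\<^sub>\<phi>) T"
      using from_nat_into[of "insert (z\<^sub>\<phi>, q\<^sub>\<phi>, k z\<^sub>\<phi>) T" i'] by (simp add: e_def)
    then show ?thesis using T(2) by auto
  qed (simp add: e_def)
  have e_surj: "\<exists>i. e i = t" if "t \<in> T" for t
  proof -
    have "\<exists>i. from_nat_into (insert (z\<^sub>\<phi>, q\<^sub>\<phi>, k z\<^sub>\<phi>) T) i = t"
      using from_nat_into_surj[of "insert (z\<^sub>\<phi>, q\<^sub>\<phi>, k z\<^sub>\<phi>) T" t] T(1) that by auto
    then obtain i where "from_nat_into (insert (z\<^sub>\<phi>, q\<^sub>\<phi>, k z\<^sub>\<phi>) T) i = t" by blast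
    then have "e (Suc i) = t" by (simp add: e_def)
    then show ?thesis by blast
  qed
  have z0: "z 0 = z\<^sub>\<phi>" "p 0 = q\<^sub>\<phi>" by (simp_all add: z_def p_def e_def)
  have items: "z i \<in> Z \<and> k (z i) \<le> p i \<and> e i = (z i, p i, k (z i))" for i
    using e_cases[of i]
  proof (elim disjE bexE)
    fix x assume x: "x \<in> G" "e i = (s x, r (s x), k (s x))"
    then have "s x \<in> Z" "k (s x) \<le> r (s x)"
      using s pr[OF x(1)] by (simp_all add: G_def)
    then show ?thesis using x(2) by (simp add: z_def p_def)
  qed (simp add: z_def p_def z_phi q_phi)
  then have zZ: "z i \<in> Z" and kp: "k (z i) \<le> p i" and ek: "e i = (z i, p i, k (z i))" for i
    by blast+
  have u_z: "f x (z i) - p i \<le> u x" if "x \<in> space M" for x i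
    using e_cases[of i]
  proof (elim disjE bexE)
    fix x' assume "x' \<in> G" "e i = (s x', r (s x'), k (s x'))"
    then show ?thesis using u_ge[OF that] by (simp add: z_def p_def)
  qed (use u_phi[OF that] in \<open>simp add: z_def p_def\<close>)
  define q where "q i = p i - \<tau> * (p i - k (z i))" for i
  have qk: "q i - k (z i) = (1 - \<tau>) * (p i - k (z i))" for i
    by (simp add: q_def algebra_simps)
  have qk_nonneg: "k (z i) \<le> q i" for i
    using qk[of i] kp[of i] \<tau> by (smt (verit) mult_nonneg_nonneg)
  have "\<exists>j :: 'x \<Rightarrow> nat. (\<forall>x i. i \<le> n \<longrightarrow> f x (z i) - q i \<le> f x (z (j x)) - q (j x)) \<and>
      j \<in> M \<rightarrow>\<^sub>M count_space UNIV \<and>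
      enn2ereal (\<integral>\<^sup>+x. ennreal (q (j x) - k (z (j x))) \<partial>M) \<le> max_profit M u\<^sub>0 f Z k"
      (is "\<exists>j. ?P n j") for n
  proof -
    have "q 0 \<le> p 0" unfolding q_def using kp[of 0] \<tau> by simp
    then have part: "\<exists>i\<le>n. u\<^sub>0 x \<le> f x (z i) - q i" if "x \<in> space M" for x
      using reservation[OF that] by (intro exI[of _ 0]) (auto simp: z0)
    obtain j where "?P n j"
      by (rule finite_menu_profit[of n z Z f M u\<^sub>0 q k, OF zZ meas[OF zZ] part qk_nonneg]) auto
    then show ?thesis by (rule exI[of _ j])
  qed
  then have "\<forall>n. \<exists>j. ?P n j" by blast
  then obtain j where "\<forall>n. ?P n (j n)" by (rule choice[THEN exE])
  then have j: "\<And>n x i. i \<le> n \<Longrightarrow> f x (z i) - q i \<le> f x (z (j n x)) - q (j n x)"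
    and meas_j: "\<And>n. j n \<in> M \<rightarrow>\<^sub>M count_space UNIV"
    and profit_j: "\<And>n. enn2ereal (\<integral>\<^sup>+x. ennreal (q (j n x) - k (z (j n x))) \<partial>M) \<le> max_profit M u\<^sub>0 f Z k"
    by blast+
  define \<pi> where "\<pi> n x = ennreal (p (j n x) - k (z (j n x)))" for n x
  have meas_\<pi>: "\<pi> n \<in> borel_measurable M" for n
    unfolding \<pi>_def using meas_j by (rule measurable_compose) simp
  have int_\<pi>: "(\<integral>\<^sup>+x. \<pi> n x \<partial>M) \<le> e2ennreal (max_profit M u\<^sub>0 f Z k) / ennreal (1 - \<tau>)" for n
  proof -
    have "ennreal (1 - \<tau>) * (\<integral>\<^sup>+x. \<pi> n x \<partial>M) = (\<integral>\<^sup>+x. ennreal (q (j n x) - k (z (j n x))) \<partial>M)"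
      using \<tau> kp meas_\<pi> by (subst nn_integral_cmult[symmetric]) (auto simp: \<pi>_def qk ennreal_mult)
    also have "\<dots> \<le> e2ennreal (max_profit M u\<^sub>0 f Z k)"
      using e2ennreal_mono[OF profit_j[of n]] by simp
    finally have "(\<integral>\<^sup>+x. \<pi> n x \<partial>M) * ennreal (1 - \<tau>) \<le> e2ennreal (max_profit M u\<^sub>0 f Z k)"
      by (simp add: mult.commute)
    from divide_right_mono_ennreal[OF this, of "ennreal (1 - \<tau>)"] show ?thesis
      using \<tau> by (simp add: ennreal_mult_divide_eq)
  qed
  define L where "L x = liminf (\<lambda>n. \<pi> n x)" for x
  have L_ge: "ennreal (profit_at f Z k v s x) \<le> L x" if x: "x \<in> G" for x
    unfolding L_def le_Liminf_iff
  proof (intro allI impI)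
    fix y assume y: "y < ennreal (profit_at f Z k v s x)"
    then obtain y' where y': "y = ennreal y'" "0 \<le> y'" by (cases y) auto
    define m where "m = profit_at f Z k v s x"
    have y'm: "y' < m" using y y' by (simp add: m_def ennreal_less_iff)
    define \<epsilon> where "\<epsilon> = m - y'"
    have \<epsilon>: "\<epsilon> > 0" using y'm by (simp add: \<epsilon>_def)
    have xM: "x \<in> space M" using x by (simp add: G_def)
    \<comment> \<open>An error of \<open>2 * \<delta>\<close> in the values costs
      \<open>\<epsilon> / 2\<close> of the margin after division by \<open>\<tau>\<close>; the
      sampling errors of price and cost together stay below \<open>2 * \<delta>\<close>, which is at
      most the other half of \<open>\<epsilon>\<close>.\<close>
    define \<delta> where "\<delta> = \<tau> * \<epsilon> / 4"
    have \<delta>: "\<delta> > 0" "4 * \<delta> = \<tau> * \<epsilon>" using \<epsilon> \<tau> by (simp_all add: \<delta>_def)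
    obtain d where d: "d > 0" "\<And>w. w \<in> Z \<Longrightarrow> dist w (s x) < d \<Longrightarrow> dist (f x w) (f x (s x)) < \<delta>"
      using cont[OF xM] s[OF xM] \<delta>(1) unfolding continuous_on_iff by blast
    have "(s x, r (s x), k (s x)) \<in> closure T" using T(3) x by blast
    moreover have "min d \<delta> > 0" using d(1) \<delta>(1) by simp
    ultimately obtain t where t: "t \<in> T" "dist t (s x, r (s x), k (s x)) < min d \<delta>"
      using closure_approachable by blast
    obtain i where i: "e i = t" using e_surj[OF t(1)] by blast
    have t_dist: "dist (z i, p i, k (z i)) (s x, r (s x), k (s x)) < min d \<delta>"
      using t(2) i ek[of i] by simp
    have dists: "dist (z i) (s x) < d" "dist (p i) (r (s x)) < \<delta>" "dist (k (z i)) (k (s x)) < \<delta>"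
      using t_dist dist_fst_le[of "(z i, p i, k (z i))" "(s x, r (s x), k (s x))"]
        dist_snd_le[of "(z i, p i, k (z i))" "(s x, r (s x), k (s x))"]
        dist_fst_le[of "(p i, k (z i))" "(r (s x), k (s x))"]
        dist_snd_le[of "(p i, k (z i))" "(r (s x), k (s x))"]
      by simp_all
    have fz: "dist (f x (z i)) (f x (s x)) < \<delta>" using d(2)[OF zZ dists(1)] .
    have m: "m = r (s x) - k (s x)" using pr[OF x] by (simp add: m_def)
    have "\<tau> * \<epsilon> \<le> \<epsilon>" using \<tau> \<epsilon> by simp
    then have "4 * \<delta> \<le> \<epsilon>" using \<delta>(2) by simp
    have "y < \<pi> n x" if "i \<le> n" for n
    proof -
      \<comment> \<open>At undiscounted prices item \<open>?l\<close> gives \<open>x\<close> at most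
        \<open>u x\<close>, and item \<open>i\<close> gives at least
        \<open>u x - 2 * \<delta>\<close>. So \<open>?l\<close> can be preferred on the discounted
        menu only if its discount falls short of that of \<open>i\<close> by at most
        \<open>2 * \<delta>\<close>, and discounts are \<open>\<tau>\<close> times margins.\<close>
      let ?l = "j n x"
      have "f x (z i) - p i + \<tau> * (p i - k (z i)) \<le> f x (z ?l) - p ?l + \<tau> * (p ?l - k (z ?l))"
        using j[OF that, of x] by (simp add: q_def)
      moreover have "f x (s x) - r (s x) - 2 * \<delta> \<le> f x (z i) - p i"
        using fz dists(2) unfolding dist_real_def by arith
      ultimately have "\<tau> * (p i - k (z i)) - 2 * \<delta> \<le> \<tau> * (p ?l - k (z ?l))"
        using u_z[OF xM, of ?l] us[OF x] by linarith
      then have "\<tau> * (p i - k (z i) - \<epsilon> / 2) \<le> \<tau> * (p ?l - k (z ?l))"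
        using \<delta>(2) by (simp add: right_diff_distrib)
      then have "p i - k (z i) - \<epsilon> / 2 \<le> p ?l - k (z ?l)" using \<tau> by simp
      moreover have "m - \<epsilon> / 2 < p i - k (z i)"
        using dists(2,3) m \<open>4 * \<delta> \<le> \<epsilon>\<close> unfolding dist_real_def by arith
      ultimately have "y' < p ?l - k (z ?l)" using y'm unfolding \<epsilon>_def by argo
      then show ?thesis using y' by (simp add: \<pi>_def ennreal_less_iff)
    qed
    then show "\<forall>\<^sub>F n in sequentially. y < \<pi> n x"
      by (rule eventually_sequentiallyI)
  qed
  show thesis
  proof
    show "L \<in> borel_measurable M"
      unfolding L_def using meas_\<pi> by (intro borel_measurable_liminf)
    show "AE x in M. ennreal (profit_at f Z k v s x) \<le> L x"
      using arg_max AE_space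
    proof eventually_elim
      case (elim x)
      show ?case
      proof (cases "0 \<le> profit_at f Z k v s x")
        case True
        then show ?thesis using elim L_ge by (simp add: G_def)
      qed (simp add: ennreal_neg)
    qed
    have "(\<integral>\<^sup>+x. L x \<partial>M) \<le> liminf (\<lambda>n. \<integral>\<^sup>+x. \<pi> n x \<partial>M)"
      unfolding L_def using meas_\<pi> by (rule nn_integral_liminf)
    also have "\<dots> \<le> liminf (\<lambda>n. e2ennreal (max_profit M u\<^sub>0 f Z k) / ennreal (1 - \<tau>))"
      using int_\<pi> by (intro Liminf_mono) simp
    finally have "(\<integral>\<^sup>+x. L x \<partial>M) \<le> e2ennreal (max_profit M u\<^sub>0 f Z k) / ennreal (1 - \<tau>)"
      by (simp add: Liminf_const)
    then have "ennreal (1 - \<tau>) * (\<integral>\<^sup>+x. L x \<partial>M)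
        \<le> ennreal (1 - \<tau>) * (e2ennreal (max_profit M u\<^sub>0 f Z k) / ennreal (1 - \<tau>))"
      by (rule mult_left_mono) simp
    also have "\<dots> = e2ennreal (max_profit M u\<^sub>0 f Z k)"
      using \<tau> by (simp add: ennreal_times_divide mult.commute[of "ennreal (1 - \<tau>)"] ennreal_mult_divide_eq)
    finally show "ennreal (1 - \<tau>) * (\<integral>\<^sup>+x. L x \<partial>M) \<le> e2ennreal (max_profit M u\<^sub>0 f Z k)" .
  qed
qed

text \<open>The infimum of the majorants along a sequence of discount rates tending to 0 is still
  measurable and still dominates almost everywhere, while the factor lost to the discount tends to
  1.\<close>

lemma profit_bound:
  assumes "\<And>x. x \<in> space M \<Longrightarrow> \<bar>utility f Z v x\<bar> \<noteq> \<infinity>"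
    and "\<And>x. x \<in> space M \<Longrightarrow> ereal (u\<^sub>0 x) \<le> utility f Z v x"
    and "\<And>x. x \<in> space M \<Longrightarrow> s x \<in> Z"
    and "AE x in M. is_arg_max (\<lambda>z. ereal (f x z) - v z) (\<lambda>z. z \<in> Z) (s x)"
  obtains L where "L \<in> borel_measurable M" "AE x in M. ennreal (profit_at f Z k v s x) \<le> L x"
    "enn2ereal (\<integral>\<^sup>+x. L x \<partial>M) \<le> max_profit M u\<^sub>0 f Z k"
proof -
  let ?B = "e2ennreal (max_profit M u\<^sub>0 f Z k)"
  \<comment> \<open>The shift by 2 keeps every rate strictly between 0 and 1, including the one for
    \<open>n = 0\<close>.\<close>
  define \<tau> where "\<tau> n = 1 / real (n + 2)" for n
  have \<tau>: "0 < \<tau> n" "\<tau> n < 1" for n by (auto simp: \<tau>_def)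
  have "\<exists>L. L \<in> borel_measurable M \<and> (AE x in M. ennreal (profit_at f Z k v s x) \<le> L x) \<and>
      ennreal (1 - \<tau> n) * (\<integral>\<^sup>+x. L x \<partial>M) \<le> ?B" for n
    using discounted_profit_bound[OF assms \<tau>[of n]] by metis
  then obtain L where L: "\<And>n. L n \<in> borel_measurable M"
    "\<And>n. AE x in M. ennreal (profit_at f Z k v s x) \<le> L n x"
    "\<And>n. ennreal (1 - \<tau> n) * (\<integral>\<^sup>+x. L n x \<partial>M) \<le> ?B" by metis
  define I where "I x = (INF n. L n x)" for x
  have I_le_\<tau>: "ennreal (1 - \<tau> n) * (\<integral>\<^sup>+x. I x \<partial>M) \<le> ?B" for n
  proof -
    have "(\<integral>\<^sup>+x. I x \<partial>M) \<le> (\<integral>\<^sup>+x. L n x \<partial>M)"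
      unfolding I_def by (intro nn_integral_mono INF_lower) simp
    then show ?thesis using L(3)[of n] by (meson mult_left_mono order_trans zero_le)
  qed
  have I_le: "(\<integral>\<^sup>+x. I x \<partial>M) \<le> ?B"
  proof (cases "(\<integral>\<^sup>+x. I x \<partial>M) < top")
    case True
    have "\<tau> \<longlonglongrightarrow> 0"
      unfolding \<tau>_def using LIMSEQ_ignore_initial_segment[OF lim_1_over_n, of 2] by simp
    then have "(\<lambda>n. ennreal (1 - \<tau> n)) \<longlonglongrightarrow> ennreal (1 - 0)"
      by (intro tendsto_ennrealI tendsto_diff tendsto_const)
    from ennreal_tendsto_cmult[OF True this]
    have "(\<lambda>n. (\<integral>\<^sup>+x. I x \<partial>M) * ennreal (1 - \<tau> n)) \<longlonglongrightarrow> (\<integral>\<^sup>+x. I x \<partial>M)" by simp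
    then show ?thesis
      using I_le_\<tau> by (intro LIMSEQ_le_const2) (auto simp: mult.commute)
  next
    \<comment> \<open>Multiplication is not continuous at an infinite integral, but then a single
      rate already forces the bound to be infinite.\<close>
    case False
    then show ?thesis
      using I_le_\<tau>[of 0] \<tau>(2)[of 0] by (simp add: ennreal_mult_top not_less top_unique)
  qed
  show thesis
  proof
    show "I \<in> borel_measurable M" unfolding I_def using L(1) by measurable
    have "AE x in M. \<forall>n. ennreal (profit_at f Z k v s x) \<le> L n x"
      using L(2) by (simp add: AE_all_countable)
    then show "AE x in M. ennreal (profit_at f Z k v s x) \<le> I x"
      by eventually_elim (auto simp: I_def intro: INF_greatest)
    show "enn2ereal (\<integral>\<^sup>+x. I x \<partial>M) \<le> max_profit M u\<^sub>0 f Z k"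
      using I_le max_profit_nonneg by (metis enn2ereal_e2ennreal less_eq_ennreal.rep_eq)
  qed
qed

text \<open>Dropping the negative part of \<open>\<pi>\<^sub>0\<close> can only raise its integral,
  and the positive part lies below the measurable majorant of the larger profit.\<close>

lemma dominated_profit_le:
  assumes "\<And>x. x \<in> space M \<Longrightarrow> \<bar>utility f Z v x\<bar> \<noteq> \<infinity>"
    and "\<And>x. x \<in> space M \<Longrightarrow> ereal (u\<^sub>0 x) \<le> utility f Z v x"
    and "\<And>x. x \<in> space M \<Longrightarrow> s x \<in> Z"
    and "AE x in M. is_arg_max (\<lambda>z. ereal (f x z) - v z) (\<lambda>z. z \<in> Z) (s x)"
    and le: "\<And>x. x \<in> space M \<Longrightarrow> \<pi>\<^sub>0 x \<le> profit_at f Z k v s x"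
  shows "ext_integral M \<pi>\<^sub>0 \<le> max_profit M u\<^sub>0 f Z k"
proof -
  obtain L where L: "AE x in M. ennreal (profit_at f Z k v s x) \<le> L x"
    "enn2ereal (\<integral>\<^sup>+x. L x \<partial>M) \<le> max_profit M u\<^sub>0 f Z k"
    using profit_bound[OF assms(1-4)] by blast
  have "ext_integral M \<pi>\<^sub>0 \<le> enn2ereal (\<integral>\<^sup>+x. ennreal (\<pi>\<^sub>0 x) \<partial>M)"
    unfolding ext_integral_def using ereal_diff_le_self by (simp add: enn2ereal_nonneg)
  also have "(\<integral>\<^sup>+x. ennreal (\<pi>\<^sub>0 x) \<partial>M) \<le> (\<integral>\<^sup>+x. L x \<partial>M)"
    using L(1) AE_space by (intro nn_integral_mono_AE) (auto elim!: eventually_elim2 dest!: le intro: order_trans ennreal_leI)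
  then have "enn2ereal (\<integral>\<^sup>+x. ennreal (\<pi>\<^sub>0 x) \<partial>M) \<le> enn2ereal (\<integral>\<^sup>+x. L x \<partial>M)"
    by (simp add: less_eq_ennreal.rep_eq)
  also note L(2)
  finally show ?thesis .
qed

text \<open>If a measurable minorant of the profit already earns the maximum, it agrees with the profit
  almost everywhere. The choices are changed on the exceptional null set, as the measure need not
  be complete.\<close>
lemma dominated_profit_attained:
  assumes ninf: "\<And>z. z \<in> Z \<Longrightarrow> v z \<noteq> -\<infinity>"
    and util: "\<And>x. x \<in> space M \<Longrightarrow> \<bar>utility f Z v x\<bar> \<noteq> \<infinity>"
    "\<And>x. x \<in> space M \<Longrightarrow> ereal (u\<^sub>0 x) \<le> utility f Z v x"
    and s: "\<And>x. x \<in> space M \<Longrightarrow> s x \<in> Z"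
    and arg_max: "AE x in M. is_arg_max (\<lambda>z. ereal (f x z) - v z) (\<lambda>z. z \<in> Z) (s x)"
    and le: "\<And>x. x \<in> space M \<Longrightarrow> \<pi>\<^sub>0 x \<le> profit_at f Z k v s x"
    and util_meas: "(\<lambda>x. utility f Z v x) \<in> borel_measurable M"
    and \<pi>\<^sub>0: "ext_integral_defined M \<pi>\<^sub>0" "ext_integral M \<pi>\<^sub>0 = max_profit M u\<^sub>0 f Z k"
      "\<bar>ext_integral M \<pi>\<^sub>0\<bar> \<noteq> \<infinity>"
  obtains t where "(v, t) \<in> offers M u\<^sub>0 f Z k" "profit M f Z k (v, t) = max_profit M u\<^sub>0 f Z k"
proof -
  obtain L where L: "L \<in> borel_measurable M" "AE x in M. ennreal (profit_at f Z k v s x) \<le> L x"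
    "enn2ereal (\<integral>\<^sup>+x. L x \<partial>M) \<le> max_profit M u\<^sub>0 f Z k"
    using profit_bound[OF util s arg_max] by blast
  have meas_\<pi>\<^sub>0 [measurable]: "\<pi>\<^sub>0 \<in> borel_measurable M"
    using \<pi>\<^sub>0(1) by (simp add: ext_integral_defined_def)
  define I J where "I = (\<integral>\<^sup>+x. ennreal (\<pi>\<^sub>0 x) \<partial>M)" and "J = (\<integral>\<^sup>+x. ennreal (- \<pi>\<^sub>0 x) \<partial>M)"
  have le_L: "AE x in M. ennreal (\<pi>\<^sub>0 x) \<le> L x"
    using L(2) AE_space by eventually_elim (meson le ennreal_leI order_trans)
  have "I \<le> (\<integral>\<^sup>+x. L x \<partial>M)"
    unfolding I_def using le_L by (rule nn_integral_mono_AE)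
  moreover have "enn2ereal (\<integral>\<^sup>+x. L x \<partial>M) \<le> enn2ereal I - enn2ereal J"
    using L(3) \<pi>\<^sub>0(2) by (simp add: ext_integral_def I_def J_def)
  moreover have "\<bar>enn2ereal I - enn2ereal J\<bar> \<noteq> \<infinity>"
    using \<pi>\<^sub>0(3) by (simp add: ext_integral_def I_def J_def)
  \<comment> \<open>The chain
    \<open>I \<le> (\<integral>\<^sup>+x. L x \<partial>M) \<le> I - J\<close> with a finite right
    end leaves no room: \<open>J\<close> vanishes and both inequalities are equalities.\<close>
  ultimately have IJ: "(\<integral>\<^sup>+x. L x \<partial>M) = I" "I < \<infinity>" "J = 0"
    by (cases I; cases J; cases "\<integral>\<^sup>+x. L x \<partial>M"; simp add: ennreal.rep_eq)+
  have "(\<integral>\<^sup>+x. (L x - ennreal (\<pi>\<^sub>0 x)) \<partial>M) = 0"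
    using nn_integral_diff[of L M "\<lambda>x. ennreal (\<pi>\<^sub>0 x)"] L(1) le_L IJ by (simp add: I_def)
  then have "AE x in M. L x - ennreal (\<pi>\<^sub>0 x) = 0"
    using L(1) by (subst (asm) nn_integral_0_iff_AE) auto
  moreover have "AE x in M. ennreal (- \<pi>\<^sub>0 x) = 0"
    using IJ(3) unfolding J_def by (subst (asm) nn_integral_0_iff_AE) auto
  ultimately have "AE x in M. profit_at f Z k v s x = \<pi>\<^sub>0 x \<and>
      is_arg_max (\<lambda>z. ereal (f x z) - v z) (\<lambda>z. z \<in> Z) (s x)"
    using arg_max L(2) AE_space
  proof eventually_elim
    case (elim x)
    have "0 \<le> \<pi>\<^sub>0 x" using elim(2) by (simp add: ennreal_eq_0_iff)
    moreover have "ennreal (profit_at f Z k v s x) \<le> ennreal (\<pi>\<^sub>0 x)"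
      using elim(1,4) by (metis diff_eq_0_iff_ennreal order_trans)
    ultimately show ?case using le[OF elim(5)] elim(3) by simp
  qed
  then obtain N where N: "N \<in> null_sets M" "\<And>x. x \<in> space M - N \<Longrightarrow> profit_at f Z k v s x = \<pi>\<^sub>0 x \<and>
      is_arg_max (\<lambda>z. ereal (f x z) - v z) (\<lambda>z. z \<in> Z) (s x)"
    by (rule AE_E3) blast
  \<comment> \<open>Buying the one fixed good \<open>z\<^sub>\<phi>\<close> on \<open>N\<close>
    makes the profit there an explicit measurable function, since utility and preference for a fixed
    good are measurable.\<close>
  define t where "t x = (if x \<in> N then z\<^sub>\<phi> else s x)" for x
  have AE_N: "AE x in M. x \<notin> N" using N(1) by (rule AE_not_in)
  have pr: "profit_at f Z k v t x =
      (if x \<in> N then f x z\<^sub>\<phi> - real_of_ereal (utility f Z v x) - k z\<^sub>\<phi> else \<pi>\<^sub>0 x)"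
    if "x \<in> space M" for x
    using N(2)[of x] that by (simp add: profit_at_def t_def)
  have [measurable]: "N \<in> sets M" using N(1) by blast
  note [measurable] = util_meas meas[OF z_phi]
  have meas_pr: "profit_at f Z k v t \<in> borel_measurable M"
    by (subst measurable_cong[OF pr]) measurable
  have pr_AE: "AE x in M. profit_at f Z k v t x = \<pi>\<^sub>0 x"
    using AE_N AE_space by eventually_elim (simp add: pr)
  have int: "(\<integral>\<^sup>+x. ennreal (profit_at f Z k v t x) \<partial>M) = I"
    "(\<integral>\<^sup>+x. ennreal (- profit_at f Z k v t x) \<partial>M) = J"
    unfolding I_def J_def using pr_AE by (auto intro!: nn_integral_cong_AE)
  have "AE x in M. is_arg_max (\<lambda>z. ereal (f x z) - v z) (\<lambda>z. z \<in> Z) (t x)"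
    using AE_N AE_space by eventually_elim (use N(2) in \<open>simp add: t_def\<close>)
  then have "(v, t) \<in> offers M u\<^sub>0 f Z k"
    using ninf util s z_phi meas_pr int IJ by (auto simp: offers_def ext_integral_defined_def t_def)
  moreover have "profit M f Z k (v, t) = max_profit M u\<^sub>0 f Z k"
    using \<pi>\<^sub>0(2) by (simp add: profit_def ext_integral_def int I_def J_def)
  ultimately show thesis by (rule that)
qed

end

section \<open>Passage between the original and the effective problem\<close>

text \<open>In the application \<open>Q y = D\<^sub>xb(x\<^sub>0, y)\<close> and \<open>\<beta> y = b(x\<^sub>0, y)\<close>.\<close>
locale reduction = screening M u\<^sub>0 h "Q ` S" g z\<^sub>\<phi> q\<^sub>\<phi>
  for M :: "'x measure" and u\<^sub>0 and h :: "'x \<Rightarrow> 'w::euclidean_space \<Rightarrow> real" and Q :: "'y \<Rightarrow> 'w"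
    and S g z\<^sub>\<phi> q\<^sub>\<phi> +
  fixes b :: "'x \<Rightarrow> 'y \<Rightarrow> real" and c \<beta> :: "'y \<Rightarrow> real"
  assumes ne: "space M \<noteq> {}"
    and pref: "\<And>x y. x \<in> space M \<Longrightarrow> y \<in> S \<Longrightarrow> h x (Q y) = b x y - \<beta> y"
    and cost_le: "\<And>y. y \<in> S \<Longrightarrow> g (Q y) \<le> c y - \<beta> y"
    and cost_attained: "\<And>w. w \<in> Q ` S \<Longrightarrow> \<exists>y\<in>S. Q y = w \<and> g w = c y - \<beta> y"
    and utility_measurable: "\<And>p. (\<lambda>x. utility h (Q ` S) p x) \<in> borel_measurable M"
begin

text \<open>The shift by \<open>\<beta>\<close> enters preference, price and cost alike and cancels
  in values and margins. With a cost-minimal \<open>\<sigma> w\<close> in each fibre the profits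
  agree pointwise, so in this direction measurability carries over for free.\<close>

lemma lift_offer:
  assumes "(p, t) \<in> offers M u\<^sub>0 h (Q ` S) g"
  obtains v s where "(v, s) \<in> offers M u\<^sub>0 b S c" "profit M b S c (v, s) = profit M h (Q ` S) g (p, t)"
    "\<forall>x\<in>space M. utility b S v x = utility h (Q ` S) p x"
proof -
  have p: "\<And>w. w \<in> Q ` S \<Longrightarrow> p w \<noteq> -\<infinity>"
    "\<And>x. x \<in> space M \<Longrightarrow> \<bar>utility h (Q ` S) p x\<bar> \<noteq> \<infinity> \<and> ereal (u\<^sub>0 x) \<le> utility h (Q ` S) p x"
    "\<And>x. x \<in> space M \<Longrightarrow> t x \<in> Q ` S"
    "AE x in M. is_arg_max (\<lambda>w. ereal (h x w) - p w) (\<lambda>w. w \<in> Q ` S) (t x)"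
    "ext_integral_defined M (profit_at h (Q ` S) g p t)"
    using assms by (auto simp: offers_def)
  obtain \<sigma> where \<sigma>: "\<And>w. w \<in> Q ` S \<Longrightarrow> \<sigma> w \<in> S \<and> Q (\<sigma> w) = w \<and> g w = c (\<sigma> w) - \<beta> (\<sigma> w)"
    using cost_attained by metis
  define v where "v y = p (Q y) + ereal (\<beta> y)" for y
  define s where "s x = \<sigma> (t x)" for x
  have s: "s x \<in> S" "Q (s x) = t x" "g (t x) = c (s x) - \<beta> (s x)" if "x \<in> space M" for x
    using \<sigma> p(3) that by (auto simp: s_def)
  have val: "ereal (b x y) - v y = ereal (h x (Q y)) - p (Q y)" if "x \<in> space M" "y \<in> S" for x y
    using pref[OF that] unfolding v_def by (cases "p (Q y)") auto
  have util: "utility b S v x = utility h (Q ` S) p x" if "x \<in> space M" for x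
    unfolding utility_def image_image using val[OF that] by (intro SUP_cong) auto
  have pr: "profit_at b S c v s x = profit_at h (Q ` S) g p t x" if "x \<in> space M" for x
    using pref[OF that s(1)[OF that]] s[OF that] util[OF that] by (simp add: profit_at_def)
  have int: "(\<integral>\<^sup>+x. ennreal (profit_at b S c v s x) \<partial>M) = (\<integral>\<^sup>+x. ennreal (profit_at h (Q ` S) g p t x) \<partial>M)"
    "(\<integral>\<^sup>+x. ennreal (- profit_at b S c v s x) \<partial>M) = (\<integral>\<^sup>+x. ennreal (- profit_at h (Q ` S) g p t x) \<partial>M)"
    using pr by (auto intro!: nn_integral_cong)
  have "AE x in M. is_arg_max (\<lambda>y. ereal (b x y) - v y) (\<lambda>y. y \<in> S) (s x)"
    using p(4) AE_space
  proof eventually_elim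
    case (elim x)
    then show ?case
      using is_arg_max_utility_iff[OF s(1)[OF elim(2)]] is_arg_max_utility_iff[OF p(3)[OF elim(2)]]
        val[OF elim(2) s(1)[OF elim(2)]] util[OF elim(2)] s(2)[OF elim(2)] by metis
  qed
  moreover have "v y \<noteq> -\<infinity>" if "y \<in> S" for y
    using p(1)[of "Q y"] that by (cases "p (Q y)") (auto simp: v_def)
  moreover have "ext_integral_defined M (profit_at b S c v s)"
    using p(5) int measurable_cong[of M, OF pr] by (simp add: ext_integral_defined_def)
  ultimately have "(v, s) \<in> offers M u\<^sub>0 b S c"
    using p(2) util s(1) by (auto simp: offers_def)
  then show thesis
    using util int that by (auto simp: profit_def ext_integral_def)
qed

text \<open>The conclusion stops short of membership in \<open>offers\<close>: the profit can only
  grow, because \<open>g\<close> is at most the shifted cost of the good bought before, but its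
  integral need not be defined.\<close>

lemma push_offer:
  assumes "(v, s) \<in> offers M u\<^sub>0 b S c"
  obtains p where "\<forall>w\<in>Q ` S. p w \<noteq> -\<infinity>"
    "\<forall>x\<in>space M. utility h (Q ` S) p x = utility b S v x"
    "AE x in M. is_arg_max (\<lambda>w. ereal (h x w) - p w) (\<lambda>w. w \<in> Q ` S) (Q (s x))"
    "\<forall>x\<in>space M. profit_at b S c v s x \<le> profit_at h (Q ` S) g p (\<lambda>x. Q (s x)) x"
proof -
  have v: "\<And>y. y \<in> S \<Longrightarrow> v y \<noteq> -\<infinity>" "\<And>x. x \<in> space M \<Longrightarrow> \<bar>utility b S v x\<bar> \<noteq> \<infinity>"
    "\<And>x. x \<in> space M \<Longrightarrow> s x \<in> S"
    "AE x in M. is_arg_max (\<lambda>y. ereal (b x y) - v y) (\<lambda>y. y \<in> S) (s x)"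
    using assms by (auto simp: offers_def)
  define p where "p w = (INF y\<in>{y \<in> S. Q y = w}. v y - ereal (\<beta> y))" for w
  have p_ge: "ereal (h x w) - utility b S v x \<le> p w" if x: "x \<in> space M" for x w
    unfolding p_def
  proof (rule INF_greatest)
    fix y assume y: "y \<in> {y \<in> S. Q y = w}"
    show "ereal (h x w) - utility b S v x \<le> v y - ereal (\<beta> y)"
      using utility_ge[of y S b x v] y pref[OF x, of y] v(1)[of y] v(2)[OF x]
      by (cases "v y"; cases "utility b S v x") auto
  qed
  \<comment> \<open>A single type with finite utility bounds the infimum from below, which is why
    the type space has to be nonempty.\<close>
  have p_ninf: "p w \<noteq> -\<infinity>" for w
  proof -
    obtain x where x: "x \<in> space M" using ne by blast
    then show ?thesis using p_ge[OF x, of w] v(2)[OF x] by (cases "utility b S v x") auto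
  qed
  have val: "ereal (b x y) - v y \<le> ereal (h x (Q y)) - p (Q y)" if "x \<in> space M" "y \<in> S" for x y
  proof -
    have "p (Q y) \<le> v y - ereal (\<beta> y)" unfolding p_def using that by (intro INF_lower) auto
    then show ?thesis
      using pref[OF that] p_ninf[of "Q y"] v(1)[OF that(2)] by (cases "v y"; cases "p (Q y)") auto
  qed
  have util: "utility h (Q ` S) p x = utility b S v x" if x: "x \<in> space M" for x
  proof (rule antisym)
    show "utility h (Q ` S) p x \<le> utility b S v x"
      unfolding utility_def[of h]
    proof (rule SUP_least)
      fix w
      show "ereal (h x w) - p w \<le> utility b S v x"
        using p_ge[OF x, of w] p_ninf[of w] v(2)[OF x] by (cases "p w"; cases "utility b S v x") auto
    qed
    show "utility b S v x \<le> utility h (Q ` S) p x"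
      unfolding utility_def[of b] using val[OF x] utility_ge[of _ "Q ` S" h x p]
      by (intro SUP_least) (meson image_eqI order_trans)
  qed
  have "AE x in M. is_arg_max (\<lambda>w. ereal (h x w) - p w) (\<lambda>w. w \<in> Q ` S) (Q (s x))"
    using v(4) AE_space
  proof eventually_elim
    case (elim x)
    have sx: "s x \<in> S" using v(3) elim(2) .
    then have "utility b S v x \<le> ereal (b x (s x)) - v (s x)"
      using elim(1) is_arg_max_utility_iff by metis
    also have "\<dots> \<le> ereal (h x (Q (s x))) - p (Q (s x))" using val[OF elim(2) sx] .
    finally show ?case using sx util[OF elim(2)] by (simp add: is_arg_max_utility_iff)
  qed
  moreover have "profit_at b S c v s x \<le> profit_at h (Q ` S) g p (\<lambda>x. Q (s x)) x"
    if x: "x \<in> space M" for x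
    using pref[OF x v(3)[OF x]] cost_le[OF v(3)[OF x]] util[OF x] by (simp add: profit_at_def)
  ultimately show thesis using p_ninf util that by blast
qed

lemma max_profit_eq: "max_profit M u\<^sub>0 b S c = max_profit M u\<^sub>0 h (Q ` S) g"
proof (rule antisym)
  show "max_profit M u\<^sub>0 h (Q ` S) g \<le> max_profit M u\<^sub>0 b S c"
    unfolding max_profit_def[of _ _ h]
  proof (rule SUP_least)
    fix a assume "a \<in> offers M u\<^sub>0 h (Q ` S) g"
    then obtain p t where a: "a = (p, t)" "(p, t) \<in> offers M u\<^sub>0 h (Q ` S) g" by (cases a) auto
    obtain v s where vs: "(v, s) \<in> offers M u\<^sub>0 b S c"
      "profit M b S c (v, s) = profit M h (Q ` S) g (p, t)"
      "\<forall>x\<in>space M. utility b S v x = utility h (Q ` S) p x"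
      by (rule lift_offer[OF a(2)])
    show "profit M h (Q ` S) g a \<le> max_profit M u\<^sub>0 b S c"
      using SUP_upper[OF vs(1), of "profit M b S c"] vs(2) by (simp add: a(1) max_profit_def)
  qed
  show "max_profit M u\<^sub>0 b S c \<le> max_profit M u\<^sub>0 h (Q ` S) g"
    unfolding max_profit_def[of _ _ b]
  proof (rule SUP_least)
    fix a assume "a \<in> offers M u\<^sub>0 b S c"
    then obtain v s where a: "a = (v, s)" and vs: "(v, s) \<in> offers M u\<^sub>0 b S c" by (cases a) auto
    obtain p where p: "\<forall>w\<in>Q ` S. p w \<noteq> -\<infinity>"
      "\<forall>x\<in>space M. utility h (Q ` S) p x = utility b S v x"
      "AE x in M. is_arg_max (\<lambda>w. ereal (h x w) - p w) (\<lambda>w. w \<in> Q ` S) (Q (s x))"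
      "\<forall>x\<in>space M. profit_at b S c v s x \<le> profit_at h (Q ` S) g p (\<lambda>x. Q (s x)) x"
      by (rule push_offer[OF vs])
    have "ext_integral M (profit_at b S c v s) \<le> max_profit M u\<^sub>0 h (Q ` S) g"
      using vs p(2) by (intro dominated_profit_le[OF _ _ _ p(3) p(4)[rule_format]]) (auto simp: offers_def)
    then show "profit M b S c a \<le> max_profit M u\<^sub>0 h (Q ` S) g"
      by (simp add: a profit_def)
  qed
qed

lemma optimal_utility_iff:
  "optimal_utility M u\<^sub>0 b S c u \<longleftrightarrow> optimal_utility M u\<^sub>0 h (Q ` S) g u"
proof
  assume "optimal_utility M u\<^sub>0 h (Q ` S) g u"
  then obtain p t where pt: "(p, t) \<in> offers M u\<^sub>0 h (Q ` S) g"
    "profit M h (Q ` S) g (p, t) = max_profit M u\<^sub>0 h (Q ` S) g"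
    "\<bar>profit M h (Q ` S) g (p, t)\<bar> \<noteq> \<infinity>" "\<forall>x\<in>space M. utility h (Q ` S) p x = ereal (u x)"
    unfolding optimal_utility_def Bex_def split_paired_Ex case_prod_conv by (elim exE conjE)
  obtain v s where "(v, s) \<in> offers M u\<^sub>0 b S c"
    "profit M b S c (v, s) = profit M h (Q ` S) g (p, t)"
    "\<forall>x\<in>space M. utility b S v x = utility h (Q ` S) p x"
    by (rule lift_offer[OF pt(1)])
  then show "optimal_utility M u\<^sub>0 b S c u"
    using pt max_profit_eq unfolding optimal_utility_def by (intro bexI[of _ "(v, s)"]) auto
next
  assume "optimal_utility M u\<^sub>0 b S c u"
  then obtain v s where vs: "(v, s) \<in> offers M u\<^sub>0 b S c"
    "profit M b S c (v, s) = max_profit M u\<^sub>0 b S c" "\<bar>profit M b S c (v, s)\<bar> \<noteq> \<infinity>"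
    "\<forall>x\<in>space M. utility b S v x = ereal (u x)"
    unfolding optimal_utility_def Bex_def split_paired_Ex case_prod_conv by (elim exE conjE)
  obtain p where p: "\<forall>w\<in>Q ` S. p w \<noteq> -\<infinity>"
    "\<forall>x\<in>space M. utility h (Q ` S) p x = utility b S v x"
    "AE x in M. is_arg_max (\<lambda>w. ereal (h x w) - p w) (\<lambda>w. w \<in> Q ` S) (Q (s x))"
    "\<forall>x\<in>space M. profit_at b S c v s x \<le> profit_at h (Q ` S) g p (\<lambda>x. Q (s x)) x"
    by (rule push_offer[OF vs(1)])
  have d: "\<And>x. x \<in> space M \<Longrightarrow> \<bar>utility h (Q ` S) p x\<bar> \<noteq> \<infinity>"
    "\<And>x. x \<in> space M \<Longrightarrow> ereal (u\<^sub>0 x) \<le> utility h (Q ` S) p x"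
    "\<And>x. x \<in> space M \<Longrightarrow> Q (s x) \<in> Q ` S" "ext_integral_defined M (profit_at b S c v s)"
    using vs(1) p(2) by (auto simp: offers_def)
  have e: "ext_integral M (profit_at b S c v s) = max_profit M u\<^sub>0 h (Q ` S) g"
    "\<bar>ext_integral M (profit_at b S c v s)\<bar> \<noteq> \<infinity>"
    using vs(2,3) max_profit_eq by (simp_all add: profit_def)
  obtain t where "(p, t) \<in> offers M u\<^sub>0 h (Q ` S) g"
    "profit M h (Q ` S) g (p, t) = max_profit M u\<^sub>0 h (Q ` S) g"
    by (rule dominated_profit_attained[OF p(1)[rule_format] d(1-3) p(3) p(4)[rule_format] utility_measurable d(4) e])
  then show "optimal_utility M u\<^sub>0 h (Q ` S) g u"
    using vs p(2) max_profit_eq unfolding optimal_utility_def by (intro bexI[of _ "(p, t)"]) auto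
qed

end

section \<open>The hypotheses of the reduction in the given setting\<close>

theorem corollary5p2:
  fixes X :: "(real^'m) set" and Y :: "(real^'n) set"
    and b :: "real^'m \<Rightarrow> real^'n \<Rightarrow> real" and c :: "real^'n \<Rightarrow> real"
    and x\<^sub>0 :: "real^'m" and y\<^sub>\<phi> :: "real^'n"
    and \<rho> :: "real^'m \<Rightarrow> real" and \<mu> :: "(real^'m) measure"
    and u\<^sub>\<phi> :: "real^'m \<Rightarrow> real"
    and W :: "(real^'m) set" and h :: "real^'m \<Rightarrow> real^'m \<Rightarrow> real" and g :: "real^'m \<Rightarrow> real"
  assumes dims: "CARD('n) > CARD('m)"
    and X: "X \<noteq> {}" "open X" "bounded X"
    and Y: "Y \<noteq> {}" "open Y" "bounded Y"
    and b_C4: "Ck_nbhd 4 (closure X \<times> closure Y) (\<lambda>(x, y). b x y)"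
    and levels_y: "\<And>x q. x \<in> closure X \<Longrightarrow> connected {y \<in> closure Y. Dx b x y = q}"
    and levels_x: "\<And>y q. y \<in> closure Y \<Longrightarrow> connected {x \<in> closure X. Dy b x y = q}"
    and full_rank: "\<And>x y. x \<in> closure X \<Longrightarrow> y \<in> closure Y \<Longrightarrow>
          rank (D2xy b x y) = min CARD('m) CARD('n)"
    and X_b_convex: "b_convex b X Y"
    and L_indep: "\<And>x x' y. x \<in> closure X \<Longrightarrow> x' \<in> closure X \<Longrightarrow> y \<in> closure Y \<Longrightarrow>
          Lset b Y y x = Lset b Y y x'"
    and x0: "x\<^sub>0 \<in> X"
    and W_def: "W = eff_goods b Y x\<^sub>0"
    and h_def: "h = eff_pref b Y x\<^sub>0"
    and g_def: "g = eff_cost b Y c x\<^sub>0"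
    and g_attained: "\<And>w. w \<in> W \<Longrightarrow> \<exists>y\<in>closure Y. Dx b x\<^sub>0 y = w \<and>
          (\<forall>y'\<in>closure Y. Dx b x\<^sub>0 y' = w \<longrightarrow> c y - b x\<^sub>0 y \<le> c y' - b x\<^sub>0 y')"
    and density: "\<rho> \<in> borel_measurable (lebesgue_on X)" "\<And>x. x \<in> X \<Longrightarrow> 0 \<le> \<rho> x"
    and \<mu>_def: "\<mu> = density (lebesgue_on X) (\<lambda>x. ennreal (\<rho> x))"
    and y_phi: "y\<^sub>\<phi> \<in> closure Y"
    and u_phi_def: "u\<^sub>\<phi> = (\<lambda>x. b x y\<^sub>\<phi> - c y\<^sub>\<phi>)"
  shows "max_profit \<mu> u\<^sub>\<phi> b (closure Y) c = max_profit \<mu> u\<^sub>\<phi> h W g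
    \<and> (\<forall>u. optimal_utility \<mu> u\<^sub>\<phi> b (closure Y) c u \<longleftrightarrow> optimal_utility \<mu> u\<^sub>\<phi> h W g u)"
proof -
  let ?Q = "Dx b x\<^sub>0" and ?S = "closure Y"
  have x0': "x\<^sub>0 \<in> closure X" using x0 closure_subset by blast
  obtain U where U: "open U" "closure X \<times> closure Y \<subseteq> U" and "Ck_on 4 U (\<lambda>(x, y). b x y)"
    using b_C4 unfolding Ck_nbhd_def by blast
  moreover have "4 = Suc (Suc 2)" by simp
  ultimately have F: "Ck_on 2 U (\<lambda>(x, y). b x y)" by (metis Ck_on_Suc)
  have contF: "continuous_on U (\<lambda>(x, y). b x y)" using F by (rule Ck_on_continuous)
  have cont_x: "continuous_on X (\<lambda>x. b x y)" if "y \<in> ?S" for y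
  proof -
    have "continuous_on X (\<lambda>x. (\<lambda>(x, y). b x y) (x, y))"
      by (rule continuous_on_compose2[OF contF])
        (use that U(2) closure_subset[of X] in \<open>auto intro!: continuous_intros\<close>)
    then show ?thesis by simp
  qed
  have cont_y: "continuous_on ?S (b x)" if "x \<in> closure X" for x
  proof -
    have "continuous_on ?S (\<lambda>y. (\<lambda>(x, y). b x y) (x, y))"
      by (rule continuous_on_compose2[OF contF])
        (use that U(2) in \<open>auto intro!: continuous_intros\<close>)
    then show ?thesis by simp
  qed
  have W: "W = ?Q ` ?S" by (simp add: W_def eff_goods_def)
  have pref: "h x (?Q y) = b x y - b x\<^sub>0 y" if x: "x \<in> X" and y: "y \<in> ?S" for x y
    unfolding h_def eff_pref_def
  proof (rule the_equality)
    have x': "x \<in> closure X" using x closure_subset by blast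
    show "\<forall>y'\<in>?S. ?Q y' = ?Q y \<longrightarrow> b x y - b x\<^sub>0 y = b x y' - b x\<^sub>0 y'"
    proof (intro ballI impI)
      fix y' assume y': "y' \<in> ?S" "?Q y' = ?Q y"
      \<comment> \<open>Equal marginal preferences at \<open>x\<^sub>0\<close> put \<open>y'\<close>
        into the level set of \<open>y\<close>, and this set is the same at every type.\<close>
      have "Dx b x'' y = Dx b x'' y'" if "x'' \<in> closure X" for x''
      proof -
        have "y' \<in> Lset b Y y x\<^sub>0" using y' by (simp add: Lset_def)
        then have "y' \<in> Lset b Y y x''" using L_indep[OF that x0' y] by simp
        then show ?thesis by (simp add: Lset_def)
      qed
      from preference_difference_constant[OF dims X(3) U F levels_x full_rank X_b_convex y y'(1) this x' x0']
      show "b x y - b x\<^sub>0 y = b x y' - b x\<^sub>0 y'" by simp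
    qed
  qed (use y in blast)
  \<comment> \<open>A real-valued \<open>INF\<close> is unspecified for sets unbounded below;
    attainment of the minimum gives \<open>eff_cost\<close> its intended value.\<close>
  have cost: "g w = c y - b x\<^sub>0 y"
    if "y \<in> ?S" "?Q y = w" "\<forall>y'\<in>?S. ?Q y' = w \<longrightarrow> c y - b x\<^sub>0 y \<le> c y' - b x\<^sub>0 y'" for w y
    unfolding g_def eff_cost_def using that by (intro cInf_eq_minimum) auto
  have cost_le: "g (?Q y) \<le> c y - b x\<^sub>0 y" if y: "y \<in> ?S" for y
  proof -
    obtain y' where y': "y' \<in> ?S" "?Q y' = ?Q y"
      "\<forall>z\<in>?S. ?Q z = ?Q y \<longrightarrow> c y' - b x\<^sub>0 y' \<le> c z - b x\<^sub>0 z"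
      using g_attained[of "?Q y"] y W by blast
    then show ?thesis using cost[OF y'] y by auto
  qed
  have space: "space \<mu> = X" by (simp add: \<mu>_def)
  have h_cont_x: "continuous_on X (\<lambda>x. h x w)" if w: "w \<in> ?Q ` ?S" for w
  proof -
    obtain y where y: "y \<in> ?S" "w = ?Q y" using w by blast
    have "continuous_on X (\<lambda>x. b x y - b x\<^sub>0 y)"
      by (intro continuous_intros cont_x y)
    then show ?thesis using pref[OF _ y(1)] y(2) by (simp cong: continuous_on_cong)
  qed
  have Xleb: "X \<in> sets lebesgue" using X(2) by simp
  \<comment> \<open>The price is the shifted cost of \<open>y\<^sub>\<phi>\<close>: selling
    \<open>?Q y\<^sub>\<phi>\<close> at it yields exactly \<open>u\<^sub>\<phi>\<close>, and it
    covers the effective cost, which is a minimum over the fibre of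
    \<open>y\<^sub>\<phi>\<close>.\<close>
  interpret reduction \<mu> u\<^sub>\<phi> h ?Q ?S g "?Q y\<^sub>\<phi>" "c y\<^sub>\<phi> - b x\<^sub>0 y\<^sub>\<phi>" b c "b x\<^sub>0"
  proof
    show "(\<lambda>x. h x w) \<in> borel_measurable \<mu>" if "w \<in> ?Q ` ?S" for w
      using continuous_imp_measurable_on_sets_lebesgue[OF h_cont_x[OF that] Xleb] by (simp add: \<mu>_def)
    show "continuous_on (?Q ` ?S) (h x)" if "x \<in> space \<mu>" for x
    proof (rule continuous_on_factor)
      have x: "x \<in> X" "x \<in> closure X" using that space closure_subset by auto
      show "compact ?S" using Y(3) by simp
      show "continuous_on ?S ?Q"
        using U(2) x0' by (intro continuous_on_Dx[OF _ F]) auto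
      have "continuous_on ?S (\<lambda>y. b x y - b x\<^sub>0 y)"
        by (intro continuous_intros cont_y x x0')
      then show "continuous_on ?S (h x \<circ> ?Q)"
        using pref[OF x(1)] by (simp cong: continuous_on_cong)
    qed
    show "?Q y\<^sub>\<phi> \<in> ?Q ` ?S" using y_phi by simp
    show "g (?Q y\<^sub>\<phi>) \<le> c y\<^sub>\<phi> - b x\<^sub>0 y\<^sub>\<phi>" using cost_le y_phi by simp
    show "u\<^sub>\<phi> x = h x (?Q y\<^sub>\<phi>) - (c y\<^sub>\<phi> - b x\<^sub>0 y\<^sub>\<phi>)" if "x \<in> space \<mu>" for x
      using pref[of x y\<^sub>\<phi>] that space y_phi by (simp add: u_phi_def)
    show "space \<mu> \<noteq> {}" using X(1) space by simp
    show "h x (?Q y) = b x y - b x\<^sub>0 y" if "x \<in> space \<mu>" "y \<in> ?S" for x y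
      using pref that space by simp
    show "g (?Q y) \<le> c y - b x\<^sub>0 y" if "y \<in> ?S" for y using cost_le that .
    show "\<exists>y\<in>?S. ?Q y = w \<and> g w = c y - b x\<^sub>0 y" if "w \<in> ?Q ` ?S" for w
      using g_attained[of w] cost that W by blast
    show "(\<lambda>x. utility h (?Q ` ?S) p x) \<in> borel_measurable \<mu>" for p
    proof (rule borel_measurable_utility)
      show "open (space \<mu>)" using X(2) space by simp
      show "S \<in> sets \<mu>" if "open S" "S \<subseteq> space \<mu>" for S
        using that space Xleb by (simp add: \<mu>_def sets_restrict_space_iff)
      show "continuous_on (space \<mu>) (\<lambda>x. h x w)" if "w \<in> ?Q ` ?S" for w
        using h_cont_x that space by simp
    qed
  qed
  show ?thesis using max_profit_eq optimal_utility_iff W by simp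
qed

end
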